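(* Let $k$ be a positive integer. The sharp threshold bias for the $(a:1)$ minimum degree-$k$ game between RandomMaker and CleverBreaker (played on the edge set of $K_n$) is $\ln\ln n$. That is, for every $\epsilon>0$: (a) RandomMaker wins the $((1+\epsilon)\ln\ln n:1)$-biased minimum degree-$k$ game a.a.s. against any strategy of CleverBreaker; and (b) CleverBreaker has a strategy against which RandomMaker loses the $((1-\epsilon)\ln\ln n:1)$-biased minimum degree-$k$ game a.a.s.
   Context: In an $(a:1)$-biased Maker-Breaker game on $E(K_n)$, Maker and Breaker alternately take turns claiming previously unclaimed (free) edges of the complete graph $K_n$; Maker goes first, Maker claims $a$ edges in each of his turns and Breaker claims $1$ edge in each of his turns, until no free edge is left (if fewer edges remain than a player should claim, he claims all of them). Maker wins the minimum degree-$k$ game if the graph of the edges he claimed has minimum degree at least $k$; otherwise Breaker wins. RandomMaker is a Maker each of whose moves (a move is the claiming of one edge) is a uniformly random edge among all currently free edges. CleverBreaker plays according to a strategy, i.e. a set of rules specifying what he does in every possible game situation. "Game" and "strategy" mean a sequence of games and a sequence of strategies, one for each number $n$ of vertices. "A.a.s." means with probability tending to $1$ as $n\to\infty$. Biases are integers; rounding of non-integer quantities is omitted (it does not affect the asymptotic statement). Definition: a function $f(n)$ is a sharp threshold bias of the $(a:1)$ half-random game between RandomMaker and CleverBreaker if for every $\epsilon>0$: (a) RandomMaker wins the $((1+\epsilon)f(n):1)$-biased game a.a.s. against any strategy of CleverBreaker, and (b) CleverBreaker has a strategy against which RandomMaker loses the $((1-\epsilon)f(n):1)$-biased game a.a.s.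 *)

theory Defs
  imports "HOL-Probability.Probability"
begin

type_synonym edge = "nat set"

definition complete_edges :: "nat \<Rightarrow> edge set" where
  "complete_edges n = {e. e \<subseteq> {..<n} \<and> card e = 2}"

text \<open>
  A game situation is the chronological list of all edges claimed so far, by either player.
  In the \<open>(a:1)\<close> game every round consists of \<open>a\<close> moves of Maker followed by one move of
  Breaker, so the position of an edge in the list determines who claimed it. A final turn that
  is cut short because the free edges run out needs no separate treatment.
\<close>

type_synonym history = "edge list"

definition maker_to_move :: "nat \<Rightarrow> nat \<Rightarrow> bool" where
  "maker_to_move a i \<longleftrightarrow> i mod (a + 1) < a"

definition free_edges :: "nat \<Rightarrow> history \<Rightarrow> edge set" where
  "free_edges n h = complete_edges n - set h"

definition maker_edges :: "nat \<Rightarrow> history \<Rightarrow> edge set" where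
  "maker_edges a h = {h ! i | i. i < length h \<and> maker_to_move a i}"

type_synonym strategy = "history \<Rightarrow> edge"

definition breaker_strategy :: "nat \<Rightarrow> nat \<Rightarrow> strategy \<Rightarrow> bool" where
  "breaker_strategy n a S \<longleftrightarrow>
     (\<forall>h. distinct h \<and> set h \<subseteq> complete_edges n \<and> free_edges n h \<noteq> {} \<and>
          \<not> maker_to_move a (length h) \<longrightarrow> S h \<in> free_edges n h)"

definition next_edge :: "nat \<Rightarrow> nat \<Rightarrow> strategy \<Rightarrow> history \<Rightarrow> edge pmf" where
  "next_edge n a S h =
     (if maker_to_move a (length h) then pmf_of_set (free_edges n h) else return_pmf (S h))"

primrec play :: "nat \<Rightarrow> nat \<Rightarrow> strategy \<Rightarrow> nat \<Rightarrow> history pmf" where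
  "play n a S 0 = return_pmf []"
| "play n a S (Suc t) =
     bind_pmf (play n a S t) (\<lambda>h. map_pmf (\<lambda>e. h @ [e]) (next_edge n a S h))"

text \<open>
  Each move claims one free edge, so exactly \<open>card (complete_edges n)\<close> moves are made, and
  \<open>pmf_of_set\<close> above is only ever applied to a nonempty set of free edges.
\<close>

definition half_random_game :: "nat \<Rightarrow> nat \<Rightarrow> strategy \<Rightarrow> history pmf" where
  "half_random_game n a S = play n a S (card (complete_edges n))"

text \<open>
  A game is given by Maker's winning condition: \<open>W n F\<close> says that Maker wins on \<open>K\<^sub>n\<close> if \<open>F\<close> is
  the set of edges he has claimed at the end.
\<close>

type_synonym winning_condition = "nat \<Rightarrow> edge set \<Rightarrow> bool"

definition degree_in :: "edge set \<Rightarrow> nat \<Rightarrow> nat" where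
  "degree_in F v = card {e \<in> F. v \<in> e}"

definition min_degree :: "nat \<Rightarrow> edge set \<Rightarrow> nat" where
  "min_degree n F = Min (degree_in F ` {..<n})"

definition min_degree_game :: "nat \<Rightarrow> winning_condition" where
  "min_degree_game k n F \<longleftrightarrow> k \<le> min_degree n F"

definition maker_wins_aas :: "winning_condition \<Rightarrow> (nat \<Rightarrow> nat) \<Rightarrow> (nat \<Rightarrow> strategy) \<Rightarrow> bool" where
  "maker_wins_aas W a S \<longleftrightarrow>
     (\<lambda>n. measure_pmf.prob (half_random_game n (a n) (S n)) {h. W n (maker_edges (a n) h)})
       \<longlonglongrightarrow> 1"

definition maker_loses_aas :: "winning_condition \<Rightarrow> (nat \<Rightarrow> nat) \<Rightarrow> (nat \<Rightarrow> strategy) \<Rightarrow> bool" where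
  "maker_loses_aas W a S \<longleftrightarrow>
     (\<lambda>n. measure_pmf.prob (half_random_game n (a n) (S n)) {h. \<not> W n (maker_edges (a n) h)})
       \<longlonglongrightarrow> 1"

text \<open>
  Biases are integers; the threshold statement is required for every way of rounding the real
  bias up or down, possibly differently for different \<open>n\<close>. A negative bias is rounded to \<open>0\<close>, in
  which case Maker claims nothing.
\<close>

definition rounding :: "(nat \<Rightarrow> nat) \<Rightarrow> (nat \<Rightarrow> real) \<Rightarrow> bool" where
  "rounding a b \<longleftrightarrow> (\<forall>n. a n = nat \<lfloor>b n\<rfloor> \<or> a n = nat \<lceil>b n\<rceil>)"

definition sharp_threshold_bias :: "winning_condition \<Rightarrow> (nat \<Rightarrow> real) \<Rightarrow> bool" where
  "sharp_threshold_bias W f \<longleftrightarrow>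
     (\<forall>\<epsilon>>0.
        (\<forall>a. rounding a (\<lambda>n. (1 + \<epsilon>) * f n) \<longrightarrow>
          (\<forall>S. (\<forall>n. breaker_strategy n (a n) (S n)) \<longrightarrow> maker_wins_aas W a S)) \<and>
        (\<forall>a. rounding a (\<lambda>n. (1 - \<epsilon>) * f n) \<longrightarrow>
          (\<exists>S. (\<forall>n. breaker_strategy n (a n) (S n)) \<and> maker_loses_aas W a S)))"

end

theory Submission
  imports Defs "HOL-Real_Asymp.Real_Asymp"
begin

text \<open>
  To isolate a vertex \<open>v\<close>, Breaker has to spend about \<open>n\<close> rounds on it, and meanwhile the number
  \<open>f\<close> of free edges at \<open>v\<close> falls from \<open>n\<close> to \<open>0\<close>. Maker's \<open>a\<close> random edges of one round hit \<open>v\<close>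
  with probability about \<open>2 a f / n\<^sup>2\<close>, and these numbers add up to \<open>a\<close>. An attack on a fresh
  vertex hence succeeds with probability about \<open>exp (- a)\<close>. After order \<open>n ln n\<close> Maker moves every
  vertex that Breaker has not worked on has large degree, so Breaker has time for \<open>ln n\<close> attacks, up
  to factors of order \<open>ln (ln n)\<close>. The balance \<open>exp a = ln n\<close> gives the threshold.

  Both directions make this precise by supermartingales on positions, so that the adaptivity of the
  players needs no conditioning argument.

  Above the threshold, each vertex gets a weight that assumes that Breaker attacks it in every round
  and is a supermartingale under this assumption, hence under every strategy
  (\<open>weight_maker_step\<close>). Started with about \<open>n\<close> free edges it is about \<open>exp (- a)\<close>. Summing
  over all \<open>n\<close> vertices would be too much, so a vertex is only counted from the time it has lost a
  small constant fraction of its free edges, and only if this happens in the first order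
  \<open>a n ln n\<close> moves (\<open>expected_weight_le\<close>). By counting edges only order \<open>a ln n\<close> vertices are of this
  kind, and \<open>a ln n exp (- (1 + \<delta>) ln (ln n))\<close> tends to \<open>0\<close>. All other vertices have gained
  degree \<open>k\<close> by then (\<open>prob_low_degree_at_free_vertex\<close>). The required degree \<open>k\<close> only costs a constant
  factor, because the weight decreases by a constant factor \<open>\<theta>\<close> with every Maker edge at the vertex.

  Below the threshold, Breaker always claims an edge at the least vertex that Maker has not touched.
  The number of untouched vertices stays positive for order \<open>n ln n\<close> moves
  (\<open>prob_all_touched_le\<close>), and in this time the probability that no attack has succeeded decays by a
  factor \<open>1 - p / (2 n)\<close> per round, where \<open>p\<close> is about \<open>exp (- a)\<close>
  (\<open>prob_isolation_fails_le\<close>).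
\<close>

section \<open>Supermartingales along a half-random game\<close>

definition legal :: "nat \<Rightarrow> history \<Rightarrow> bool" where
  "legal n h \<longleftrightarrow> distinct h \<and> set h \<subseteq> complete_edges n"

lemma finite_complete_edges [simp]: "finite (complete_edges n)"
  by (rule finite_subset[of _ "Pow {..<n}"]) (auto simp: complete_edges_def)

lemma card_complete_edges: "card (complete_edges n) = n choose 2"
  unfolding complete_edges_def using n_subsets[of "{..<n}" 2] by simp

lemma real_card_complete_edges: "real (card (complete_edges n)) = real n * (real n - 1) / 2"
proof -
  have "even (n * (n - 1))" by (cases n) auto
  then have "2 * card (complete_edges n) = n * (n - 1)"
    by (simp add: card_complete_edges choose_two)
  then have "2 * real (card (complete_edges n)) = real n * real (n - 1)"
    by (metis of_nat_mult of_nat_numeral)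
  then show ?thesis by (cases n) auto
qed

lemma finite_free_edges [simp]: "finite (free_edges n h)"
  by (simp add: free_edges_def)

lemma legal_Nil [simp]: "legal n []"
  by (simp add: legal_def)

lemma legal_snoc: "legal n h \<Longrightarrow> e \<in> free_edges n h \<Longrightarrow> legal n (h @ [e])"
  by (auto simp: legal_def free_edges_def)

lemma legal_take: "legal n h \<Longrightarrow> legal n (take t h)"
  unfolding legal_def using set_take_subset by fastforce

lemma card_free_edges:
  assumes "legal n h"
  shows "card (free_edges n h) = card (complete_edges n) - length h"
  using assms by (simp add: legal_def free_edges_def card_Diff_subset distinct_card)

lemma free_edges_nonempty:
  assumes "legal n h" "length h < card (complete_edges n)"
  shows "free_edges n h \<noteq> {}"
  using card_free_edges[OF assms(1)] assms(2) by fastforce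

lemma prob_Collect_not:
  "measure_pmf.prob p {h. \<not> P h} = 1 - measure_pmf.prob p {h. P h}"
  using measure_pmf.prob_compl[of "{h. P h}" p]
  by (simp add: Compl_eq_Diff_UNIV[symmetric] Collect_neg_eq[symmetric])

locale half_random =
  fixes n a :: nat and S :: strategy
  assumes breaker: "breaker_strategy n a S"
begin

lemma breaker_move_free:
  assumes "legal n h" "length h < card (complete_edges n)" "\<not> maker_to_move a (length h)"
  shows "S h \<in> free_edges n h"
  using breaker assms free_edges_nonempty[OF assms(1,2)]
  unfolding breaker_strategy_def legal_def by blast

lemma set_next_edge:
  assumes "legal n h" "length h < card (complete_edges n)"
  shows "set_pmf (next_edge n a S h) \<subseteq> free_edges n h"
  using breaker_move_free[OF assms] free_edges_nonempty[OF assms]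
  by (auto simp: next_edge_def set_pmf_of_set)

lemma play_legal:
  assumes "t \<le> card (complete_edges n)" "h \<in> set_pmf (play n a S t)"
  shows "legal n h \<and> length h = t"
  using assms
proof (induction t arbitrary: h)
  case (Suc t)
  then obtain h' e where h': "h' \<in> set_pmf (play n a S t)" "e \<in> set_pmf (next_edge n a S h')"
    "h = h' @ [e]" by auto
  have IH: "legal n h'" "length h' = t" using Suc.IH[OF _ h'(1)] Suc.prems(1) by auto
  have "e \<in> free_edges n h'" using set_next_edge[OF IH(1)] IH(2) Suc.prems(1) h'(2) by auto
  then show ?case using legal_snoc[OF IH(1)] IH(2) h'(3) by simp
qed simp

lemma finite_set_next_edge:
  assumes "legal n h" "length h < card (complete_edges n)"
  shows "finite (set_pmf (next_edge n a S h))"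
  using set_next_edge[OF assms] finite_free_edges finite_subset by blast

lemma finite_set_play:
  assumes "t \<le> card (complete_edges n)"
  shows "finite (set_pmf (play n a S t))"
  using assms
proof (induction t)
  case (Suc t)
  have "finite (set_pmf (next_edge n a S h))" if "h \<in> set_pmf (play n a S t)" for h
    using finite_set_next_edge play_legal[OF _ that] Suc.prems by auto
  then show ?case using Suc by auto
qed simp

lemma integrable_play:
  fixes f :: "history \<Rightarrow> real"
  assumes "t \<le> card (complete_edges n)"
  shows "integrable (measure_pmf (play n a S t)) f"
  using integrable_measure_pmf_finite[OF finite_set_play[OF assms]] .

lemma expectation_play_Suc:
  fixes f :: "history \<Rightarrow> real"
  assumes "Suc t \<le> card (complete_edges n)"
  shows "measure_pmf.expectation (play n a S (Suc t)) f =
    (\<Sum>h\<in>set_pmf (play n a S t). pmf (play n a S t) h *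
        measure_pmf.expectation (next_edge n a S h) (\<lambda>e. f (h @ [e])))"
proof -
  have fin: "finite (set_pmf (map_pmf (\<lambda>e. h @ [e]) (next_edge n a S h)))"
    if "h \<in> set_pmf (play n a S t)" for h
    using finite_set_next_edge play_legal[OF _ that] assms by auto
  show ?thesis
    using pmf_expectation_bind[where p = "play n a S t" and A = "set_pmf (play n a S t)" and h = f,
        OF finite_set_play fin] assms by simp
qed

text \<open>
  All probability estimates below come from this supermartingale principle together with
  \<open>markov_play\<close>. Maker's move is an average over the free edges and Breaker's move is
  deterministic, so the hypotheses are inequalities about finite sums at a single position.
\<close>

lemma expectation_le_initial:
  fixes \<Phi> :: "history \<Rightarrow> real"
  assumes T: "T \<le> card (complete_edges n)"
    and maker: "\<And>h. legal n h \<Longrightarrow> length h < T \<Longrightarrow> maker_to_move a (length h) \<Longrightarrow>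
        (\<Sum>e\<in>free_edges n h. \<Phi> (h @ [e])) \<le> card (free_edges n h) * \<Phi> h"
    and brk: "\<And>h. legal n h \<Longrightarrow> length h < T \<Longrightarrow> \<not> maker_to_move a (length h) \<Longrightarrow>
        S h \<in> free_edges n h \<Longrightarrow> \<Phi> (h @ [S h]) \<le> \<Phi> h"
  shows "measure_pmf.expectation (play n a S T) \<Phi> \<le> \<Phi> []"
proof -
  have step: "measure_pmf.expectation (next_edge n a S h) (\<lambda>e. \<Phi> (h @ [e])) \<le> \<Phi> h"
    if h: "legal n h" "length h < T" for h
  proof (cases "maker_to_move a (length h)")
    case True
    have ne: "free_edges n h \<noteq> {}" using free_edges_nonempty[OF h(1)] h(2) T by simp
    then have "card (free_edges n h) > 0" by (simp add: card_gt_0_iff)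
    then show ?thesis
      using maker[OF h True] True ne
      by (simp add: next_edge_def integral_pmf_of_set field_simps)
  next
    case False
    then show ?thesis
      using brk[OF h False] breaker_move_free[OF h(1) _ False] h(2) T
      by (simp add: next_edge_def)
  qed
  have "measure_pmf.expectation (play n a S t) \<Phi> \<le> \<Phi> []" if "t \<le> T" for t
    using that
  proof (induction t)
    case (Suc t)
    have "measure_pmf.expectation (play n a S (Suc t)) \<Phi>
        = (\<Sum>h\<in>set_pmf (play n a S t). pmf (play n a S t) h *
        measure_pmf.expectation (next_edge n a S h) (\<lambda>e. \<Phi> (h @ [e])))"
      using expectation_play_Suc Suc.prems T by simp
    also have "\<dots> \<le> (\<Sum>h\<in>set_pmf (play n a S t). pmf (play n a S t) h * \<Phi> h)"
      using play_legal[of t] step Suc.prems T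
      by (intro sum_mono mult_left_mono) auto
    also have "\<dots> = measure_pmf.expectation (play n a S t) \<Phi>"
      using integral_measure_pmf[OF finite_set_play, of t "play n a S t" \<Phi>] Suc.prems T
      by (subst integral_measure_pmf[OF finite_set_play]) auto
    also have "\<dots> \<le> \<Phi> []" using Suc by simp
    finally show ?case .
  qed simp
  then show ?thesis by simp
qed

lemma markov_play:
  fixes \<Phi> :: "history \<Rightarrow> real"
  assumes T: "T \<le> card (complete_edges n)"
    and nonneg: "\<And>h. legal n h \<Longrightarrow> length h = T \<Longrightarrow> 0 \<le> \<Phi> h"
    and ge: "\<And>h. legal n h \<Longrightarrow> length h = T \<Longrightarrow> h \<in> E \<Longrightarrow> c \<le> \<Phi> h"
  shows "c * measure_pmf.prob (play n a S T) E \<le> measure_pmf.expectation (play n a S T) \<Phi>"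
proof -
  have "c * measure_pmf.prob (play n a S T) E
      = measure_pmf.expectation (play n a S T) (\<lambda>h. c * indicator E h)"
    by simp
  also have "\<dots> \<le> measure_pmf.expectation (play n a S T) \<Phi>"
    using integrable_play[OF T] play_legal[OF T] nonneg ge
    by (intro integral_mono_AE) (auto simp: AE_measure_pmf_iff indicator_def)
  finally show ?thesis .
qed

lemma take_play:
  assumes "t \<le> T" "T \<le> card (complete_edges n)"
  shows "map_pmf (take t) (play n a S T) = play n a S t"
  using assms
proof (induction T rule: dec_induct)
  case base
  then show ?case
    using play_legal[of t] by (intro map_pmf_idI) auto
next
  case (step T)
  have "map_pmf (take t) (play n a S (Suc T))
      = bind_pmf (play n a S T) (\<lambda>h. map_pmf (\<lambda>e. take t (h @ [e])) (next_edge n a S h))"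
    by (simp add: map_bind_pmf map_pmf_comp)
  also have "\<dots> = bind_pmf (play n a S T) (\<lambda>h. return_pmf (take t h))"
    using play_legal[of T] step by (intro bind_pmf_cong) (auto simp: map_pmf_const)
  also have "\<dots> = play n a S t" using step by (simp add: map_pmf_def)
  finally show ?case .
qed

lemma prob_take:
  assumes "t \<le> T" "T \<le> card (complete_edges n)"
  shows "measure_pmf.prob (play n a S T) {h. P (take t h)} = measure_pmf.prob (play n a S t) {h. P h}"
  by (subst take_play[OF assms, symmetric]) (simp add: measure_map_pmf vimage_def)

end

section \<open>Degrees\<close>

definition free_degree :: "nat \<Rightarrow> history \<Rightarrow> nat \<Rightarrow> nat" where
  "free_degree n h v = card {e \<in> free_edges n h. v \<in> e}"

definition maker_degree :: "nat \<Rightarrow> history \<Rightarrow> nat \<Rightarrow> nat" where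
  "maker_degree a h v = degree_in (maker_edges a h) v"

lemma maker_edges_snoc:
  "maker_edges a (h @ [e]) =
     (if maker_to_move a (length h) then insert e (maker_edges a h) else maker_edges a h)"
proof -
  have "maker_edges a (h @ [e])
      = {(h @ [e]) ! i | i. i < length h \<and> maker_to_move a i}
        \<union> {(h @ [e]) ! i | i. i = length h \<and> maker_to_move a i}"
    unfolding maker_edges_def length_append_singleton less_Suc_eq by blast
  also have "{(h @ [e]) ! i | i. i < length h \<and> maker_to_move a i} = maker_edges a h"
    unfolding maker_edges_def by (auto simp: nth_append)
  also have "{(h @ [e]) ! i | i. i = length h \<and> maker_to_move a i}
      = (if maker_to_move a (length h) then {e} else {})" by auto
  finally show ?thesis by simp
qed

lemma maker_edges_subset: "maker_edges a h \<subseteq> set h"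
  by (auto simp: maker_edges_def)

lemma finite_maker_edges [simp]: "finite (maker_edges a h)"
  using maker_edges_subset finite_subset by blast

lemma maker_degree_Nil [simp]: "maker_degree a [] v = 0"
  by (simp add: maker_degree_def degree_in_def maker_edges_def)

lemma maker_degree_snoc:
  assumes "e \<in> free_edges n h"
  shows "maker_degree a (h @ [e]) v =
    (if maker_to_move a (length h) \<and> v \<in> e then Suc (maker_degree a h v) else maker_degree a h v)"
proof -
  have "e \<notin> maker_edges a h" using assms maker_edges_subset by (auto simp: free_edges_def)
  moreover have "{e' \<in> insert e (maker_edges a h). v \<in> e'} =
      (if v \<in> e then insert e {e' \<in> maker_edges a h. v \<in> e'} else {e' \<in> maker_edges a h. v \<in> e'})"
    by auto
  ultimately show ?thesis
    by (simp add: maker_degree_def degree_in_def maker_edges_snoc)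
qed

lemma maker_edges_take_subset: "maker_edges a (take t h) \<subseteq> maker_edges a h"
  by (auto simp: maker_edges_def)

lemma maker_degree_take: "maker_degree a (take t h) v \<le> maker_degree a h v"
  unfolding maker_degree_def degree_in_def
  using maker_edges_take_subset by (intro card_mono) auto

lemma free_edges_snoc: "free_edges n (h @ [e]) = free_edges n h - {e}"
  by (auto simp: free_edges_def)

lemma free_degree_snoc:
  assumes "e \<in> free_edges n h"
  shows "free_degree n (h @ [e]) v = (if v \<in> e then free_degree n h v - 1 else free_degree n h v)"
proof -
  have "{e' \<in> free_edges n h - {e}. v \<in> e'} = {e' \<in> free_edges n h. v \<in> e'} - {e}" by auto
  then show ?thesis
    using assms by (simp add: free_degree_def free_edges_snoc card_Diff_singleton_if)
qed

lemma free_degree_pos: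
  assumes "e \<in> free_edges n h" "v \<in> e"
  shows "free_degree n h v > 0"
  using assms by (auto simp: free_degree_def card_gt_0_iff)

lemma free_degree_take: "free_degree n h v \<le> free_degree n (take t h) v"
  unfolding free_degree_def free_edges_def
  by (intro card_mono) (auto dest: in_set_takeD)

lemma card_complete_edges_at:
  assumes "v < n"
  shows "card {e \<in> complete_edges n. v \<in> e} = n - 1"
proof -
  have "bij_betw (\<lambda>u. {v, u}) ({..<n} - {v}) {e \<in> complete_edges n. v \<in> e}"
  proof (intro bij_betwI')
    fix x y assume "x \<in> {..<n} - {v}" "y \<in> {..<n} - {v}"
    then show "({v, x} = {v, y}) = (x = y)" by (auto simp: doubleton_eq_iff)
  next
    fix x assume "x \<in> {..<n} - {v}"
    then show "{v, x} \<in> {e \<in> complete_edges n. v \<in> e}" using assms by (auto simp: complete_edges_def)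
  next
    fix e assume "e \<in> {e \<in> complete_edges n. v \<in> e}"
    then have e: "e \<subseteq> {..<n}" "card e = 2" "v \<in> e" by (auto simp: complete_edges_def)
    then obtain x y where "e = {x, y}" "x \<noteq> y" by (auto simp: card_2_iff)
    with e show "\<exists>x\<in>{..<n} - {v}. e = {v, x}" by auto
  qed
  then have "card {e \<in> complete_edges n. v \<in> e} = card ({..<n} - {v})"
    using bij_betw_same_card by metis
  then show ?thesis using assms by simp
qed

lemma free_degree_less:
  assumes "v < n"
  shows "free_degree n h v \<le> n - 1"
  unfolding free_degree_def card_complete_edges_at[OF assms, symmetric]
  by (intro card_mono) (auto simp: free_edges_def)

lemma free_degree_le_card: "free_degree n h v \<le> card (free_edges n h)"
  unfolding free_degree_def by (intro card_mono) auto

lemma sum_free_edges_split: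
  fixes \<Phi> :: "edge \<Rightarrow> real" and x y :: real
  assumes "\<And>e. e \<in> free_edges n h \<Longrightarrow> v \<in> e \<Longrightarrow> \<Phi> e \<le> x"
    and "\<And>e. e \<in> free_edges n h \<Longrightarrow> v \<notin> e \<Longrightarrow> \<Phi> e \<le> y"
  shows "(\<Sum>e\<in>free_edges n h. \<Phi> e) \<le>
    free_degree n h v * x + (real (card (free_edges n h)) - free_degree n h v) * y"
proof -
  have split: "free_edges n h = {e \<in> free_edges n h. v \<in> e} \<union> {e \<in> free_edges n h. v \<notin> e}" by auto
  have c: "card (free_edges n h) = free_degree n h v + card {e \<in> free_edges n h. v \<notin> e}"
    unfolding free_degree_def by (subst split, subst card_Un_disjoint) auto
  have "(\<Sum>e\<in>free_edges n h. \<Phi> e)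
      = (\<Sum>e\<in>{e \<in> free_edges n h. v \<in> e}. \<Phi> e) + (\<Sum>e\<in>{e \<in> free_edges n h. v \<notin> e}. \<Phi> e)"
    by (subst split, subst sum.union_disjoint) auto
  also have "\<dots> \<le> free_degree n h v * x + card {e \<in> free_edges n h. v \<notin> e} * y"
    unfolding free_degree_def using assms by (intro add_mono sum_bounded_above) auto
  finally show ?thesis using c by simp
qed

lemma free_degree_eq:
  assumes "legal n h" "v < n"
  shows "free_degree n h v + card {e \<in> set h. v \<in> e} = n - 1"
proof -
  have "card ({e \<in> free_edges n h. v \<in> e} \<union> {e \<in> set h. v \<in> e})
      = free_degree n h v + card {e \<in> set h. v \<in> e}"
    unfolding free_degree_def by (subst card_Un_disjoint) (auto simp: free_edges_def)
  moreover have "{e \<in> free_edges n h. v \<in> e} \<union> {e \<in> set h. v \<in> e} = {e \<in> complete_edges n. v \<in> e}"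
    using assms(1) by (auto simp: free_edges_def legal_def)
  ultimately show ?thesis using card_complete_edges_at[OF assms(2)] by simp
qed

lemma sum_claimed_degrees:
  assumes "legal n h"
  shows "(\<Sum>v<n. card {e \<in> set h. v \<in> e}) = 2 * length h"
proof -
  have "card {v \<in> {..<n}. v \<in> e} = 2" if "e \<in> set h" for e
  proof -
    have "{v \<in> {..<n}. v \<in> e} = e" "card e = 2"
      using assms that by (auto simp: legal_def complete_edges_def)
    then show ?thesis by simp
  qed
  then have "(\<Sum>v<n. card {e \<in> set h. v \<in> e}) = 2 * card (set h)"
    by (intro sum_multicount) auto
  then show ?thesis using assms by (simp add: legal_def distinct_card)
qed

lemma Suc_mod_maker:
  assumes "maker_to_move a t"
  shows "Suc t mod (a + 1) = Suc (t mod (a + 1))" "Suc t div (a + 1) = t div (a + 1)"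
    "t mod (a + 1) < a"
  using assms by (auto simp: maker_to_move_def mod_Suc div_Suc)

lemma Suc_mod_breaker:
  assumes "\<not> maker_to_move a t"
  shows "Suc t mod (a + 1) = 0" "Suc t div (a + 1) = Suc (t div (a + 1))" "t mod (a + 1) = a"
proof -
  have "t mod (a + 1) < a + 1" by (rule mod_less_divisor) simp
  with assms show "t mod (a + 1) = a" unfolding maker_to_move_def by linarith
  then show "Suc t mod (a + 1) = 0" "Suc t div (a + 1) = Suc (t div (a + 1))"
    by (auto simp: mod_Suc div_Suc)
qed

section \<open>Random Maker against an arbitrary Breaker\<close>

definition maker_moves :: "nat \<Rightarrow> nat \<Rightarrow> nat" where
  "maker_moves a t = a * (t div (a + 1)) + t mod (a + 1)"

lemma maker_moves_Suc:
  "maker_moves a (Suc t) = (if maker_to_move a t then Suc (maker_moves a t) else maker_moves a t)"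
  using Suc_mod_maker[of a t] Suc_mod_breaker[of a t] by (auto simp: maker_moves_def)

text \<open>
  While at least half of the edges at \<open>v\<close> are free, every Maker move hits \<open>v\<close> with probability at
  least \<open>1 / n\<close>, and a hit halves \<open>(1 / 2) ^ d\<close> for the Maker degree \<open>d\<close> of \<open>v\<close>. Hence this
  quantity shrinks in expectation by the factor \<open>1 - 1 / (2 n)\<close>, and Markov's inequality turns
  this into a bound for \<open>d < k\<close>. The potential is set to \<open>0\<close> once \<open>v\<close> has lost too many free edges.
\<close>

lemma (in half_random) prob_low_degree_at_free_vertex:
  assumes "v < n" "n \<le> 2 * m" "t \<le> card (complete_edges n)"
  shows "measure_pmf.prob (play n a S t) {h. m < free_degree n h v \<and> maker_degree a h v < k}
    \<le> 2 ^ k * (1 - 1 / (2 * real n)) ^ maker_moves a t"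
proof -
  define \<beta> where "\<beta> = 1 - 1 / (2 * real n)"
  have \<beta>: "0 < \<beta>" using assms(1) by (simp add: \<beta>_def field_simps)
  define \<Phi> where "\<Phi> h = (if m < free_degree n h v
      then (1 / 2) ^ maker_degree a h v / \<beta> ^ maker_moves a (length h) else 0)" for h
  have nn: "0 \<le> \<Phi> h" for h using \<beta> by (simp add: \<Phi>_def)
  have "measure_pmf.expectation (play n a S t) \<Phi> \<le> \<Phi> []"
  proof (rule expectation_le_initial[OF assms(3)])
    fix h assume h: "legal n h" "length h < t" "maker_to_move a (length h)"
    let ?F = "real (card (free_edges n h))" and ?f = "real (free_degree n h v)"
    show "(\<Sum>e\<in>free_edges n h. \<Phi> (h @ [e])) \<le> ?F * \<Phi> h"
    proof (cases "m < free_degree n h v")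
      case True
      define w where "w = (1 / 2) ^ maker_degree a h v / \<beta> ^ maker_moves a (length h)"
      have w: "0 \<le> w" using \<beta> by (simp add: w_def)
      have "(\<Sum>e\<in>free_edges n h. \<Phi> (h @ [e])) \<le> ?f * (w / (2 * \<beta>)) + (?F - ?f) * (w / \<beta>)"
        using h(3) \<beta> w
        by (intro sum_free_edges_split)
           (auto simp: \<Phi>_def w_def free_degree_snoc maker_degree_snoc maker_moves_Suc mult_ac)
      also have "\<dots> = (?F - ?f / 2) * (w / \<beta>)" using \<beta> by (simp add: field_simps)
      also have "\<dots> \<le> (?F * \<beta>) * (w / \<beta>)"
      proof (intro mult_right_mono)
        have "?F \<le> real n * (real n - 1) / 2"
          unfolding real_card_complete_edges[symmetric]
          by (simp add: free_edges_def card_mono)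
        also have "\<dots> \<le> real n * (real n / 2)" by (simp add: field_simps)
        also have "\<dots> \<le> real n * ?f"
          using True assms(2) by (intro mult_left_mono) auto
        finally show "?F - ?f / 2 \<le> ?F * \<beta>"
          using assms(1) by (simp add: \<beta>_def field_simps)
        show "0 \<le> w / \<beta>" using w \<beta> by simp
      qed
      also have "\<dots> = ?F * \<Phi> h" using \<beta> True by (simp add: \<Phi>_def w_def)
      finally show ?thesis .
    next
      case False
      then have "\<Phi> (h @ [e]) = 0" if "e \<in> free_edges n h" for e
        using that by (auto simp: \<Phi>_def free_degree_snoc)
      then show ?thesis using nn by simp
    qed
  next
    fix h assume h: "legal n h" "length h < t" "\<not> maker_to_move a (length h)"
      "S h \<in> free_edges n h"
    then show "\<Phi> (h @ [S h]) \<le> \<Phi> h"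
      using \<beta> by (auto simp: \<Phi>_def free_degree_snoc maker_degree_snoc maker_moves_Suc)
  qed
  also have "\<Phi> [] \<le> 1" by (simp add: \<Phi>_def maker_moves_def)
  finally have E: "measure_pmf.expectation (play n a S t) \<Phi> \<le> 1" .
  let ?E = "{h. m < free_degree n h v \<and> maker_degree a h v < k}"
  have "(1 / 2) ^ k / \<beta> ^ maker_moves a t * measure_pmf.prob (play n a S t) ?E
      \<le> measure_pmf.expectation (play n a S t) \<Phi>"
    using nn \<beta> by (intro markov_play assms(3))
      (auto simp: \<Phi>_def divide_right_mono power_decreasing)
  with E have "(1 / 2) ^ k / \<beta> ^ maker_moves a t * measure_pmf.prob (play n a S t) ?E \<le> 1"
    by linarith
  then show ?thesis using \<beta> unfolding \<beta>_def[symmetric] by (simp add: field_simps power_one_over)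
qed

text \<open>
  The danger that a vertex ends up with small Maker degree, when it has Maker degree \<open>d\<close> and \<open>f\<close>
  free edges and \<open>j\<close> moves of the present round have been made. It assumes the worst, that Breaker
  claims an edge at the vertex in every round: then \<open>exp (- c a f (f + 1) / 2)\<close> is, for
  \<open>c \<approx> 2 / n\<^sup>2\<close>, the probability that Maker never hits it again. The factor \<open>\<theta> ^ d\<close> accounts for
  the hits so far; at the end of the game, when \<open>f = 0\<close>, a vertex of degree below \<open>k\<close> still has
  weight at least \<open>\<theta> ^ k\<close>, whence all \<open>k\<close> have the same threshold. The term \<open>j f\<close> distributes the
  gain from Breaker's move over the \<open>a\<close> Maker moves of the round that pay for it.
\<close>

definition weight :: "real \<Rightarrow> real \<Rightarrow> nat \<Rightarrow> nat \<Rightarrow> nat \<Rightarrow> nat \<Rightarrow> real" where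
  "weight \<theta> c a d f j = \<theta> ^ d * exp (- c * (real a * real f * (real f + 1) / 2 - real j * real f))"

lemma weight_pos: "0 < \<theta> \<Longrightarrow> 0 < weight \<theta> c a d f j"
  by (simp add: weight_def)

lemma weight_Suc_phase: "weight \<theta> c a d f (Suc j) = weight \<theta> c a d f j * exp (c * real f)"
  by (simp add: weight_def mult.assoc exp_add[symmetric] algebra_simps)

lemma weight_breaker_claims: "0 < f \<Longrightarrow> weight \<theta> c a d (f - 1) 0 = weight \<theta> c a d f a"
  by (cases f) (auto simp: weight_def field_simps)

lemma weight_phase_mono:
  assumes "0 \<le> c" "0 < \<theta>" "i \<le> j"
  shows "weight \<theta> c a d f i \<le> weight \<theta> c a d f j"
  using assms by (auto simp: weight_def intro!: mult_left_mono mult_right_mono)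

lemma weight_at_crossing:
  assumes "0 \<le> c" "0 < \<theta>" "\<theta> \<le> 1" "j \<le> a"
  shows "weight \<theta> c a d (Suc m) j \<le> exp (- c * (real a * real m * (real m + 1) / 2))"
proof -
  have "weight \<theta> c a d (Suc m) j \<le> weight \<theta> c a d (Suc m) a"
    using assms by (intro weight_phase_mono) auto
  also have "\<dots> = weight \<theta> c a d m 0" using weight_breaker_claims[of "Suc m"] by simp
  also have "\<dots> \<le> 1 * exp (- c * (real a * real m * (real m + 1) / 2))"
    unfolding weight_def using assms by (intro mult_mono) (auto simp: power_le_one)
  finally show ?thesis by simp
qed

lemma weight_maker_claims:
  assumes "0 \<le> c" "0 < \<theta>" "0 < f" "c * (real a + 1) * real f \<le> 1 / 2"
  shows "weight \<theta> c a (Suc d) (f - 1) (Suc j) \<le> 2 * \<theta> * weight \<theta> c a d f j"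
proof -
  obtain g where g: "f = Suc g" using assms(3) by (cases f) auto
  have "weight \<theta> c a (Suc d) (f - 1) (Suc j)
      = \<theta> * weight \<theta> c a d f j * exp (c * (real a * real f + real f - real j - 1))"
    by (simp add: weight_def g mult.assoc exp_add[symmetric]) (simp add: field_simps)
  also have "\<dots> \<le> \<theta> * weight \<theta> c a d f j * 2"
  proof (intro mult_left_mono)
    have "c * (real a * real f + real f - real j - 1) \<le> c * ((real a + 1) * real f)"
      using assms(1) by (intro mult_left_mono) (auto simp: algebra_simps)
    then have "exp (c * (real a * real f + real f - real j - 1)) \<le> exp (1 / 2)"
      using assms(4) unfolding mult.assoc exp_le_cancel_iff by linarith
    also have "\<dots> \<le> 1 + 1 / 2 + (1 / 2)\<^sup>2" by (rule exp_bound) auto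
    finally show "exp (c * (real a * real f + real f - real j - 1)) \<le> 2"
      by (simp add: power2_eq_square)
    show "0 \<le> \<theta> * weight \<theta> c a d f j"
      using assms(2) weight_pos[OF assms(2)] by (simp add: less_imp_le)
  qed
  finally show ?thesis by (simp add: mult_ac)
qed

text \<open>
  The choice \<open>c = (1 - 3 \<theta>) / N\<close> balances a Maker move. Missing the vertex lets its weight grow
  by \<open>exp (c f) \<le> 1 + (1 - 2 \<theta>) f / N\<close>, where \<open>\<theta> f / N\<close> absorbs the quadratic term, and a hit,
  whose probability is \<open>f / F \<ge> f / N\<close>, multiplies the weight by at most \<open>2 \<theta>\<close>.
\<close>

lemma weight_maker_step:
  fixes F N :: real
  assumes \<theta>: "0 < \<theta>" "\<theta> \<le> 1 / 3" and N: "0 < N" "F \<le> N" "real f \<le> F"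
    and small: "real f / N \<le> \<theta>" "(real a + 1) * real f / N \<le> 1 / 2"
  defines "c \<equiv> (1 - 3 * \<theta>) / N"
  shows "real f * weight \<theta> c a (Suc d) (f - 1) (Suc j) + (F - real f) * weight \<theta> c a d f (Suc j)
    \<le> F * weight \<theta> c a d f j"
proof (cases "f = 0")
  case True
  then show ?thesis by (simp add: weight_def)
next
  case False
  define x where "x = real f / N"
  define w where "w = weight \<theta> c a d f j"
  have w: "0 < w" using weight_pos[OF \<theta>(1)] by (simp add: w_def)
  have x: "0 \<le> x" "x \<le> \<theta>" "real f = x * N" using N small by (auto simp: x_def)
  have cf: "c * real f = (1 - 3 * \<theta>) * x" by (simp add: c_def x_def)
  have c0: "0 \<le> c" using \<theta> N by (simp add: c_def)
  have cf_le: "c * real f \<le> x" "0 \<le> c * real f"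
    unfolding cf using x(1) \<theta> by (auto intro: mult_left_le_one_le)
  have "exp (c * real f) \<le> 1 + c * real f + (c * real f)\<^sup>2"
    using cf_le x(2) \<theta> by (intro exp_bound) auto
  also have "(c * real f)\<^sup>2 \<le> \<theta> * x"
    unfolding power2_eq_square using cf_le x by (intro mult_mono) auto
  finally have e: "exp (c * real f) \<le> 1 + (1 - 2 * \<theta>) * x" unfolding cf by (simp add: algebra_simps)
  have hit: "weight \<theta> c a (Suc d) (f - 1) (Suc j) \<le> 2 * \<theta> * w"
    unfolding w_def
  proof (intro weight_maker_claims)
    have "c * (real a + 1) * real f = (1 - 3 * \<theta>) * ((real a + 1) * real f / N)"
      by (simp add: c_def)
    also have "\<dots> \<le> (real a + 1) * real f / N" using \<theta> N by (intro mult_left_le_one_le) auto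
    finally show "c * (real a + 1) * real f \<le> 1 / 2" using small(2) by linarith
  qed (use False \<theta> c0 in auto)
  have "real f * weight \<theta> c a (Suc d) (f - 1) (Suc j) + (F - real f) * weight \<theta> c a d f (Suc j)
      \<le> real f * (2 * \<theta> * w) + (F - real f) * (w * (1 + (1 - 2 * \<theta>) * x))"
    using hit e N w by (intro add_mono mult_left_mono) (auto simp: weight_Suc_phase w_def[symmetric])
  also have "\<dots> = w * (F - (1 - 2 * \<theta>) * (real f - (F - real f) * x))"
    by (simp add: algebra_simps)
  also have "\<dots> \<le> w * F"
  proof -
    have "(F - real f) * x \<le> N * x" using N x by (intro mult_right_mono) auto
    then have "0 \<le> (1 - 2 * \<theta>) * (real f - (F - real f) * x)"
      using \<theta> x(3) by (intro mult_nonneg_nonneg) (auto simp: mult.commute)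
    then show ?thesis using w by (intro mult_left_mono) auto
  qed
  finally show ?thesis by (simp add: w_def mult.commute)
qed

lemma card_much_claimed:
  assumes "legal n h" "m + 2 \<le> n"
  shows "card {v. v < n \<and> free_degree n h v \<le> Suc m} * (n - 2 - m) \<le> 2 * length h"
proof -
  let ?A = "{v. v < n \<and> free_degree n h v \<le> Suc m}"
  have "card ?A * (n - 2 - m) = (\<Sum>v\<in>?A. n - 2 - m)" by simp
  also have "\<dots> \<le> (\<Sum>v\<in>?A. card {e \<in> set h. v \<in> e})"
    using free_degree_eq[OF assms(1)] by (intro sum_mono) fastforce
  also have "\<dots> \<le> (\<Sum>v<n. card {e \<in> set h. v \<in> e})" by (intro sum_mono2) auto
  finally show ?thesis using sum_claimed_degrees[OF assms(1)] by simp
qed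

lemma free_degree_no_free: "free_edges n h = {} \<Longrightarrow> free_degree n h v = 0"
  by (simp add: free_degree_def)

text \<open>
  Breaker can bring only few vertices down to \<open>m + 1\<close> free edges before time \<open>t\<close>, and only these
  may be counted, since the sum of the weights of all vertices would be too large. The weight of a
  vertex is at most \<open>W\<^sub>0\<close> at the moment when it reaches \<open>m + 1\<close> free edges. Subtracting
  \<open>W\<^sub>0\<close> and counting a vertex only from that moment on, and only if it comes before time
  \<open>t\<close>, therefore gives a supermartingale that starts at \<open>0\<close>. Its final expectation says that a
  counted vertex costs no more than \<open>W\<^sub>0\<close> on average.
\<close>

lemma (in half_random) expected_weight_le:
  assumes v: "v < n" and \<theta>: "0 < \<theta>" "\<theta> \<le> 1 / 3" and n: "2 / real n \<le> \<theta>" "2 * (real a + 1) / real n \<le> 1 / 2"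
    and m: "m + 2 < n"
  defines "W\<^sub>0 \<equiv> exp (- ((1 - 3 * \<theta>) / card (complete_edges n)) * (real a * real m * (real m + 1) / 2))"
  shows "measure_pmf.expectation (half_random_game n a S)
      (\<lambda>h. if free_degree n (take t h) v \<le> Suc m then \<theta> ^ maker_degree a h v - W\<^sub>0 else 0) \<le> 0"
proof -
  define N where "N = real (card (complete_edges n))"
  define c where "c = (1 - 3 * \<theta>) / N"
  have N: "N = real n * (real n - 1) / 2" "N > 0"
    using m by (auto simp: N_def real_card_complete_edges)
  have c0: "0 \<le> c" using \<theta> N(2) by (simp add: c_def)
  define W where "W h = weight \<theta> c a (maker_degree a h v) (free_degree n h v) (length h mod (a + 1))" for h
  define \<Phi> where "\<Phi> h = (if free_degree n (take t h) v \<le> Suc m then W h - W\<^sub>0 else 0)" for h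
  have W_crossing: "W h \<le> W\<^sub>0" if "free_degree n h v = Suc m" for h
  proof -
    have "length h mod (a + 1) \<le> a" using mod_less_divisor[of "a + 1" "length h"] by linarith
    then show ?thesis
      unfolding W_def that W\<^sub>0_def N_def[symmetric] c_def[symmetric]
      using \<theta>(2) by (intro weight_at_crossing c0 \<theta>(1)) auto
  qed
  have late: "free_degree n (take t (h @ [e])) v \<le> Suc m" if "free_degree n (take t h) v \<le> Suc m"
    "e \<in> free_edges n h" for h e
    using that free_degree_take[of n "take t (h @ [e])" v "length h"]
    by (cases "t \<le> length h") (auto simp: free_degree_snoc)
  \<comment> \<open>A move takes at most one free edge from \<open>v\<close>, so the bound is first met with equality.\<close>
  have cross: "\<Phi> (h @ [e]) \<le> 0" if "\<not> free_degree n (take t h) v \<le> Suc m" "e \<in> free_edges n h" for h e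
  proof (cases "t \<le> length h")
    case False
    then show ?thesis using that W_crossing[of "h @ [e]"]
      by (auto simp: \<Phi>_def free_degree_snoc split: if_splits)
  qed (use that in \<open>simp add: \<Phi>_def\<close>)
  have "measure_pmf.expectation (half_random_game n a S) \<Phi> \<le> \<Phi> []"
    unfolding half_random_game_def
  proof (rule expectation_le_initial[OF order.refl])
    fix h assume h: "legal n h" "length h < card (complete_edges n)" "maker_to_move a (length h)"
    let ?F = "real (card (free_edges n h))" and ?f = "free_degree n h v"
    let ?W = "weight \<theta> c a" and ?d = "maker_degree a h v" and ?j = "length h mod (a + 1)"
    show "(\<Sum>e\<in>free_edges n h. \<Phi> (h @ [e])) \<le> ?F * \<Phi> h"
    proof (cases "free_degree n (take t h) v \<le> Suc m")
      case True
      have fn: "real ?f \<le> real n - 1" using free_degree_less[OF v, of h] v by linarith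
      have "real ?f / N \<le> (real n - 1) / N" using fn N(2) by (intro divide_right_mono) auto
      also have "(real n - 1) / N = 2 / real n"
      proof -
        have *: "y / (x * y / 2) = 2 / x" if "y \<noteq> 0" for x y :: real using that by simp
        show ?thesis unfolding N(1) by (rule *) (use m in simp)
      qed
      finally have s1: "real ?f / N \<le> 2 / real n" .
      have "(real a + 1) * real ?f / N = (real a + 1) * (real ?f / N)" by simp
      also have "\<dots> \<le> (real a + 1) * (2 / real n)" using s1 by (intro mult_left_mono) auto
      also have "\<dots> = 2 * (real a + 1) / real n" by simp
      finally have s2: "(real a + 1) * real ?f / N \<le> 1 / 2" using n(2) by linarith
      have "(\<Sum>e\<in>free_edges n h. \<Phi> (h @ [e]))
          \<le> ?f * (?W (Suc ?d) (?f - 1) (Suc ?j) - W\<^sub>0) + (?F - ?f) * (?W ?d ?f (Suc ?j) - W\<^sub>0)"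
        using h(3) True late Suc_mod_maker(1)[OF h(3)]
        by (intro sum_free_edges_split)
           (auto simp: \<Phi>_def W_def free_degree_snoc maker_degree_snoc)
      also have "\<dots> \<le> ?F * (?W ?d ?f ?j - W\<^sub>0)"
        using weight_maker_step[OF \<theta> N(2), of ?F ?f a ?d ?j] s1 s2 n(1) free_degree_le_card[of n h v]
        by (auto simp: N_def free_edges_def card_mono c_def algebra_simps)
      finally show ?thesis using True by (simp add: \<Phi>_def W_def)
    next
      case False
      then have "(\<Sum>e\<in>free_edges n h. \<Phi> (h @ [e])) \<le> 0" using cross by (intro sum_nonpos) auto
      then show ?thesis using False by (simp add: \<Phi>_def)
    qed
  next
    fix h assume h: "legal n h" "\<not> maker_to_move a (length h)" "S h \<in> free_edges n h"
    show "\<Phi> (h @ [S h]) \<le> \<Phi> h"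
    proof (cases "free_degree n (take t h) v \<le> Suc m")
      case True
      have "W (h @ [S h]) \<le> W h"
        using h(2,3) Suc_mod_breaker[OF h(2)] weight_breaker_claims[OF free_degree_pos[OF h(3)], of v]
          weight_phase_mono[OF c0 \<theta>(1), of 0 a]
        by (auto simp: W_def free_degree_snoc maker_degree_snoc)
      then show ?thesis using True late h(3) by (simp add: \<Phi>_def)
    next
      case False
      then show ?thesis using cross[OF False h(3)] by (simp add: \<Phi>_def)
    qed
  qed
  also have "\<Phi> [] = 0"
  proof -
    have "Suc m < free_degree n [] v" using free_degree_eq[of n "[]" v] v m by simp
    then show ?thesis by (simp add: \<Phi>_def)
  qed
  finally have "measure_pmf.expectation (half_random_game n a S) \<Phi> \<le> 0" .
  moreover have "\<Phi> h = (if free_degree n (take t h) v \<le> Suc m then \<theta> ^ maker_degree a h v - W\<^sub>0 else 0)"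
    if "h \<in> set_pmf (half_random_game n a S)" for h
  proof -
    have "legal n h" "length h = card (complete_edges n)"
      using play_legal[OF order.refl] that unfolding half_random_game_def by auto
    then have "free_edges n h = {}" using card_free_edges[of n h] by simp
    then show ?thesis by (simp add: \<Phi>_def W_def weight_def free_degree_no_free)
  qed
  ultimately show ?thesis
    by (subst integral_cong_AE[where g = \<Phi>]) (auto simp: AE_measure_pmf_iff)
qed

lemma min_degree_game_iff:
  assumes "0 < n"
  shows "min_degree_game k n (maker_edges a h) \<longleftrightarrow> (\<forall>v<n. k \<le> maker_degree a h v)"
proof -
  have "{..<n} \<noteq> {}" using assms by auto
  then show ?thesis
    by (auto simp: min_degree_game_def min_degree_def maker_degree_def)
qed

text \<open>
  A vertex of degree below \<open>k\<close> either still has more than \<open>m + 1\<close> free edges at time \<open>t\<close>, which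
  is excluded by a union bound, or it is one of the few vertices with \<open>m + 1\<close> or fewer, and then
  it contributes at least \<open>\<theta> ^ k\<close> to the sum of the final weights. There are at most
  \<open>2 t / (n - 2 - m)\<close> of the latter, by counting the claimed edges at them.
\<close>

theorem (in half_random) prob_maker_loses_le:
  assumes \<theta>: "0 < \<theta>" "\<theta> \<le> 1 / 3" and n: "2 / real n \<le> \<theta>" "2 * (real a + 1) / real n \<le> 1 / 2"
    and m: "m + 2 < n" "n \<le> 2 * Suc m" and t: "t \<le> card (complete_edges n)"
  defines "W\<^sub>0 \<equiv> exp (- ((1 - 3 * \<theta>) / card (complete_edges n)) * (real a * real m * (real m + 1) / 2))"
  shows "measure_pmf.prob (half_random_game n a S) {h. \<not> min_degree_game k n (maker_edges a h)}
    \<le> real n * (2 ^ k * (1 - 1 / (2 * real n)) ^ maker_moves a t)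
      + W\<^sub>0 * (2 * real t / (real n - 2 - real m)) / \<theta> ^ k"
proof -
  let ?G = "half_random_game n a S" and ?N = "card (complete_edges n)"
  let ?in = "\<lambda>h v. free_degree n (take t h) v \<le> Suc m"
  define \<Phi> where "\<Phi> h = (\<Sum>v<n. if ?in h v then \<theta> ^ maker_degree a h v else 0)" for h
  define K where "K = 2 * real t / (real n - 2 - real m)"
  let ?B = "\<lambda>v. {h. Suc m < free_degree n (take t h) v \<and> maker_degree a (take t h) v < k}"
  let ?E = "{h. \<theta> ^ k \<le> \<Phi> h}"
  have sub: "{h. \<not> min_degree_game k n (maker_edges a h)} \<subseteq> (\<Union>v<n. ?B v) \<union> ?E"
  proof
    fix h assume "h \<in> {h. \<not> min_degree_game k n (maker_edges a h)}"
    then obtain v where v: "v < n" "maker_degree a h v < k"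
      using m by (auto simp: min_degree_game_iff)
    show "h \<in> (\<Union>v<n. ?B v) \<union> ?E"
    proof (cases "?in h v")
      case True
      have "\<theta> ^ k \<le> \<theta> ^ maker_degree a h v" using v \<theta> by (intro power_decreasing) auto
      also have "\<dots> = (if ?in h v then \<theta> ^ maker_degree a h v else 0)" using True by simp
      also have "\<dots> \<le> \<Phi> h" unfolding \<Phi>_def using v(1) \<theta>
        by (intro member_le_sum[where f = "\<lambda>v. if ?in h v then \<theta> ^ maker_degree a h v else 0"]) auto
      finally show ?thesis by simp
    next
      case False
      then show ?thesis using v maker_degree_take[of a t h v] by force
    qed
  qed
  have B: "measure_pmf.prob ?G (?B v) \<le> 2 ^ k * (1 - 1 / (2 * real n)) ^ maker_moves a t"
    if "v < n" for v
    unfolding half_random_game_def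
    using prob_low_degree_at_free_vertex[OF that m(2) t, of k]
    by (subst prob_take[OF t order.refl]) simp
  have int: "integrable (measure_pmf ?G) f" for f :: "history \<Rightarrow> real"
    unfolding half_random_game_def by (rule integrable_play) simp
  have "measure_pmf.expectation ?G \<Phi> \<le> measure_pmf.expectation ?G
      (\<lambda>h. (\<Sum>v<n. if ?in h v then \<theta> ^ maker_degree a h v - W\<^sub>0 else 0) + W\<^sub>0 * K)"
  proof (intro integral_mono_AE int)
    have "\<Phi> h \<le> (\<Sum>v<n. if ?in h v then \<theta> ^ maker_degree a h v - W\<^sub>0 else 0) + W\<^sub>0 * K"
      if "h \<in> set_pmf ?G" for h
    proof -
      have "legal n (take t h)" "length (take t h) = t"
        using play_legal[OF order.refl] that t legal_take unfolding half_random_game_def by auto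
      then have "card {v. v < n \<and> ?in h v} * (n - 2 - m) \<le> 2 * t"
        using card_much_claimed[of n "take t h" m] m(1) by simp
      then have "real (card {v. v < n \<and> ?in h v}) * real (n - 2 - m) \<le> 2 * real t"
        by (metis of_nat_le_iff of_nat_mult of_nat_numeral)
      then have "real (card {v. v < n \<and> ?in h v}) \<le> K"
        using m(1) by (simp add: K_def field_simps of_nat_diff)
      moreover have "\<Phi> h = (\<Sum>v<n. if ?in h v then \<theta> ^ maker_degree a h v - W\<^sub>0 else 0)
          + (\<Sum>v<n. if ?in h v then W\<^sub>0 else 0)"
        unfolding \<Phi>_def sum.distrib[symmetric] by (intro sum.cong) auto
      moreover have "(\<Sum>v<n. if ?in h v then W\<^sub>0 else 0) = card {v. v < n \<and> ?in h v} * W\<^sub>0"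
        by (subst sum.inter_filter[symmetric]) (auto simp: lessThan_def)
      ultimately show ?thesis by (simp add: W\<^sub>0_def mult.commute)
    qed
    then show "AE h in measure_pmf ?G. \<Phi> h
        \<le> (\<Sum>v<n. if ?in h v then \<theta> ^ maker_degree a h v - W\<^sub>0 else 0) + W\<^sub>0 * K"
      by (simp add: AE_measure_pmf_iff)
  qed
  also have "\<dots> = (\<Sum>v<n. measure_pmf.expectation ?G
      (\<lambda>h. if ?in h v then \<theta> ^ maker_degree a h v - W\<^sub>0 else 0)) + W\<^sub>0 * K"
    by (subst Bochner_Integration.integral_add[OF int int],
        subst Bochner_Integration.integral_sum[OF int]) simp
  also have "\<dots> \<le> 0 + W\<^sub>0 * K"
    using expected_weight_le[OF _ \<theta> n m(1)] unfolding W\<^sub>0_def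
    by (intro add_mono sum_nonpos) auto
  finally have EW: "measure_pmf.expectation ?G \<Phi> \<le> W\<^sub>0 * K" by simp
  have "\<theta> ^ k * measure_pmf.prob ?G ?E \<le> measure_pmf.expectation ?G \<Phi>"
    unfolding half_random_game_def using \<theta>
    by (intro markov_play) (auto simp: \<Phi>_def intro!: sum_nonneg)
  with EW have E: "measure_pmf.prob ?G ?E \<le> W\<^sub>0 * K / \<theta> ^ k"
    using \<theta> by (simp add: field_simps)
  have "measure_pmf.prob ?G {h. \<not> min_degree_game k n (maker_edges a h)}
      \<le> measure_pmf.prob ?G ((\<Union>v<n. ?B v) \<union> ?E)"
    using sub by (intro measure_pmf.finite_measure_mono) auto
  also have "\<dots> \<le> measure_pmf.prob ?G (\<Union>v<n. ?B v) + measure_pmf.prob ?G ?E"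
    by (intro measure_Un_le) auto
  also have "measure_pmf.prob ?G (\<Union>v<n. ?B v) \<le> (\<Sum>v<n. measure_pmf.prob ?G (?B v))"
    by (intro measure_UNION_le) auto
  also have "\<dots> \<le> real n * (2 ^ k * (1 - 1 / (2 * real n)) ^ maker_moves a t)"
    using sum_bounded_above[of "{..<n}" "\<lambda>v. measure_pmf.prob ?G (?B v)", OF B] by simp
  finally show ?thesis using E by (simp add: K_def)
qed

section \<open>Bias above the threshold\<close>

lemma rounding_bounds:
  assumes "rounding a b" "0 \<le> b n"
  shows "b n - 1 \<le> real (a n)" "real (a n) \<le> b n + 1"
proof -
  have "real (nat \<lfloor>b n\<rfloor>) = of_int \<lfloor>b n\<rfloor>" "real (nat \<lceil>b n\<rceil>) = of_int \<lceil>b n\<rceil>"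
    using assms(2) by (simp_all add: of_nat_nat)
  moreover have "a n = nat \<lfloor>b n\<rfloor> \<or> a n = nat \<lceil>b n\<rceil>" using assms(1) by (simp add: rounding_def)
  ultimately show "b n - 1 \<le> real (a n)" "real (a n) \<le> b n + 1" by linarith+
qed

lemma maker_moves_rounds: "maker_moves a ((a + 1) * R) = a * R"
  by (simp add: maker_moves_def del: mult_Suc)

text \<open>
  The phase before time \<open>t\<close> lasts \<open>\<lceil>4 n ln n\<rceil>\<close> rounds, so Maker makes at least that many moves
  and a given vertex then has degree below \<open>k\<close> and more than \<open>m + 1\<close> free edges with probability
  at most \<open>2 ^ k / n\<^sup>2\<close>, small enough for a union bound over all vertices. The constant
  \<open>\<theta>\<close> solves \<open>(1 - 5 \<theta>) (1 + \<delta>) = 1 + \<delta> / 2\<close>: the loss of \<open>3 \<theta>\<close> in the exponent of the weight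
  and the restriction to \<open>m \<ge> (1 - \<theta>) n\<close> cost a factor \<open>(1 - 3 \<theta>) (1 - \<theta>)\<^sup>2 \<ge> 1 - 5 \<theta>\<close>.
\<close>

lemma prob_maker_loses_le_explicit:
  fixes b :: real
  assumes brk: "breaker_strategy n a S"
    and \<delta>: "0 < \<delta>" "\<theta> = \<delta> / (10 * (1 + \<delta>))"
    and a: "1 \<le> a" "(1 + \<delta>) * ln (ln (real n)) \<le> real a" "real a \<le> b" and n: "1 \<le> ln (real n)"
    and big: "2 / real n \<le> \<theta>" "2 * (b + 1) / real n \<le> 1 / 2" "\<theta> * real n > 3"
      "(b + 1) * (4 * real n * ln (real n) + 1) \<le> real n * (real n - 1) / 2"
  shows "measure_pmf.prob (half_random_game n a S) {h. \<not> min_degree_game k n (maker_edges a h)}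
    \<le> 2 ^ k / real n + exp (- (1 + \<delta> / 2) * ln (ln (real n)))
      * (2 * ((b + 1) * (4 * real n * ln (real n) + 1)) / (\<theta> * real n - 3)) / \<theta> ^ k"
proof -
  interpret half_random n a S by standard (rule brk)
  have \<theta>: "0 < \<theta>" "\<theta> \<le> 1 / 10"
    unfolding \<delta>(2) using \<delta>(1) by (simp_all add: field_simps)
  have n0: "0 < real n" using \<theta> big(3) by (auto intro: ccontr)
  define R where "R = nat \<lceil>4 * real n * ln (real n)\<rceil>"
  define t where "t = (a + 1) * R"
  define m where "m = nat \<lceil>(1 - \<theta>) * real n\<rceil>"
  have "0 \<le> 4 * real n * ln (real n)" using n by simp
  then have R: "4 * real n * ln (real n) \<le> real R" "real R \<le> 4 * real n * ln (real n) + 1"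
    unfolding R_def by linarith+
  have "0 \<le> (1 - \<theta>) * real n" using \<theta> by simp
  then have m: "(1 - \<theta>) * real n \<le> real m" "real m \<le> (1 - \<theta>) * real n + 1"
    unfolding m_def by linarith+
  have t: "real t \<le> (b + 1) * (4 * real n * ln (real n) + 1)"
    unfolding t_def of_nat_mult using R a by (intro mult_mono) auto
  have nm: "\<theta> * real n - 3 \<le> real n - 2 - real m" using m(2) by (simp add: algebra_simps)
  have c1: "2 * (real a + 1) / real n \<le> 1 / 2"
  proof -
    have "2 * (real a + 1) / real n \<le> 2 * (b + 1) / real n" using a n0 by (intro divide_right_mono) auto
    then show ?thesis using big(2) by linarith
  qed
  have c2: "m + 2 < n" using nm big(3) by linarith
  have c3: "n \<le> 2 * Suc m"
  proof -
    have "real n / 2 \<le> (1 - \<theta>) * real n" using \<theta> n0 by (simp add: field_simps)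
    then have "real n \<le> real (2 * Suc m)" using m(1) by simp
    then show ?thesis by (simp only: of_nat_le_iff)
  qed
  have "real t \<le> real (card (complete_edges n))"
    unfolding real_card_complete_edges using t big(4) by linarith
  then have c4: "t \<le> card (complete_edges n)" by simp
  define W where "W = exp (- ((1 - 3 * \<theta>) / card (complete_edges n)) * (real a * real m * (real m + 1) / 2))"
  have "measure_pmf.prob (half_random_game n a S) {h. \<not> min_degree_game k n (maker_edges a h)}
    \<le> real n * (2 ^ k * (1 - 1 / (2 * real n)) ^ (a * R)) + W * (2 * real t / (real n - 2 - real m)) / \<theta> ^ k"
    using prob_maker_loses_le[OF \<theta>(1) _ big(1) c1 c2 c3 c4] \<theta> unfolding W_def t_def maker_moves_rounds
    by simp
  also have "\<dots> \<le> 2 ^ k / real n + exp (- (1 + \<delta> / 2) * ln (ln (real n)))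
      * (2 * ((b + 1) * (4 * real n * ln (real n) + 1)) / (\<theta> * real n - 3)) / \<theta> ^ k"
  proof (intro add_mono divide_right_mono mult_mono)
    have "(1 - 1 / (2 * real n)) ^ (a * R) \<le> (1 - 1 / (2 * real n)) ^ R"
      using a(1) c2 by (intro power_decreasing) (auto simp: field_simps)
    also have "\<dots> \<le> exp (- (1 / (2 * real n))) ^ R"
      using exp_ge_add_one_self[of "- (1 / (2 * real n))"] c2 by (intro power_mono) (auto simp: field_simps)
    also have "\<dots> = exp (- (real R / (2 * real n)))"
      by (simp add: exp_of_nat_mult[symmetric])
    also have "\<dots> \<le> exp (- (2 * ln (real n)))"
      using R(1) n0 by (simp add: field_simps)
    also have "\<dots> = 1 / (real n * real n)"
      using n0 by (simp only: exp_minus mult_2 exp_add exp_ln inverse_eq_divide)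
    finally have "real n * (2 ^ k * (1 - 1 / (2 * real n)) ^ (a * R)) \<le> real n * (2 ^ k * (1 / (real n * real n)))"
      by (intro mult_left_mono) auto
    then show "real n * (2 ^ k * (1 - 1 / (2 * real n)) ^ (a * R)) \<le> 2 ^ k / real n"
      using n0 by simp
    have L: "0 \<le> ln (ln (real n))" using n by simp
    have nn: "0 < real n * (real n - 1)" using c2 n0 by (intro mult_pos_pos) auto
    have "(1 - \<theta>) * real n * ((1 - \<theta>) * real n) \<le> real m * (real m + 1)"
      using m(1) \<theta> n0 by (intro mult_mono) auto
    moreover have "(1 - \<theta>)\<^sup>2 * (real n * (real n - 1)) \<le> (1 - \<theta>)\<^sup>2 * (real n * real n)"
      using n0 by (intro mult_left_mono) auto
    ultimately have mm: "(1 - \<theta>)\<^sup>2 \<le> real m * (real m + 1) / (real n * (real n - 1))"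
      using nn by (simp add: pos_le_divide_eq power2_eq_square mult_ac)
    have "(1 + \<delta> / 2) * ln (ln (real n)) = (1 - 5 * \<theta>) * ((1 + \<delta>) * ln (ln (real n)))"
    proof -
      have "(1 - 5 * \<theta>) * (1 + \<delta>) = 1 + \<delta> / 2"
        unfolding \<delta>(2) using \<delta>(1) by (simp add: field_simps)
      then show ?thesis by (simp add: mult.assoc[symmetric])
    qed
    also have "\<dots> \<le> ((1 - 3 * \<theta>) * (1 - \<theta>)\<^sup>2) * real a"
    proof (intro mult_mono a)
      have "(1 - 3 * \<theta>) * (1 - \<theta>)\<^sup>2 - (1 - 5 * \<theta>) = \<theta>\<^sup>2 * (7 - 3 * \<theta>)"
        by (simp add: power2_eq_square algebra_simps)
      also have "\<dots> \<ge> 0" using \<theta> by (intro mult_nonneg_nonneg) auto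
      finally show "1 - 5 * \<theta> \<le> (1 - 3 * \<theta>) * (1 - \<theta>)\<^sup>2" by linarith
    qed (use L \<delta>(1) \<theta> in auto)
    also have "\<dots> \<le> ((1 - 3 * \<theta>) * (real m * (real m + 1) / (real n * (real n - 1)))) * real a"
      using mm \<theta> by (intro mult_right_mono mult_left_mono) auto
    also have "\<dots> = (1 - 3 * \<theta>) / card (complete_edges n) * (real a * real m * (real m + 1) / 2)"
    proof -
      have *: "s * (z / (x * y)) * w = s / (x * y / 2) * (w * z / 2)" for s w x y z :: real
        by (simp add: mult_ac)
      show ?thesis unfolding real_card_complete_edges
        using * [of _ "real m * (real m + 1)"] by (simp only: mult.assoc)
    qed
    finally have "(1 + \<delta> / 2) * ln (ln (real n))
      \<le> (1 - 3 * \<theta>) / card (complete_edges n) * (real a * real m * (real m + 1) / 2)" .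
    then show "W \<le> exp (- (1 + \<delta> / 2) * ln (ln (real n)))"
      unfolding W_def exp_le_cancel_iff mult_minus_left by (rule le_imp_neg_le)
    show "0 \<le> 2 * real t / (real n - 2 - real m)"
      using c2 by (intro divide_nonneg_nonneg) auto
    show "2 * real t / (real n - 2 - real m)
        \<le> 2 * ((b + 1) * (4 * real n * ln (real n) + 1)) / (\<theta> * real n - 3)"
      using t nm big(3) by (intro frac_le) auto
    show "0 \<le> \<theta> ^ k" using \<theta> by simp
  qed (rule exp_ge_zero)
  finally show ?thesis .
qed

theorem maker_wins_above_threshold:
  assumes \<epsilon>: "0 < \<epsilon>" and a: "rounding a (\<lambda>n. (1 + \<epsilon>) * ln (ln (real n)))"
    and S: "\<And>n. breaker_strategy n (a n) (S n)"
  shows "maker_wins_aas (min_degree_game k) a S"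
proof -
  define \<delta> where "\<delta> = \<epsilon> / 2"
  define \<theta> where "\<theta> = \<delta> / (10 * (1 + \<delta>))"
  define b where "b n = (1 + \<epsilon>) * ln (ln (real n)) + 1" for n
  have \<delta>: "0 < \<delta>" using \<epsilon> by (simp add: \<delta>_def)
  then have \<theta>: "0 < \<theta>" by (simp add: \<theta>_def)
  let ?P = "\<lambda>n. measure_pmf.prob (half_random_game n (a n) (S n))"
  let ?fail = "\<lambda>n. ?P n {h. \<not> min_degree_game k n (maker_edges (a n) h)}"
  let ?bound = "\<lambda>n. 2 ^ k / real n + exp (- (1 + \<delta> / 2) * ln (ln (real n)))
      * (2 * ((b n + 1) * (4 * real n * ln (real n) + 1)) / (\<theta> * real n - 3)) / \<theta> ^ k"
  have "eventually (\<lambda>n. ?fail n \<le> ?bound n) sequentially"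
  proof -
    have "eventually (\<lambda>n. 1 \<le> ln (real n)) sequentially"
      unfolding b_def using \<delta> \<theta> \<epsilon> by real_asymp
    moreover have "eventually (\<lambda>n. 1 \<le> \<delta> * ln (ln (real n))) sequentially"
      unfolding b_def using \<delta> \<theta> \<epsilon> by real_asymp
    moreover have "eventually (\<lambda>n. 1 \<le> ln (ln (real n))) sequentially"
      unfolding b_def using \<delta> \<theta> \<epsilon> by real_asymp
    moreover have "eventually (\<lambda>n. 2 / real n \<le> \<theta>) sequentially"
      unfolding b_def using \<delta> \<theta> \<epsilon> by real_asymp
    moreover have "eventually (\<lambda>n. 2 * (b n + 1) / real n \<le> 1 / 2) sequentially"
      unfolding b_def using \<delta> \<theta> \<epsilon> by real_asymp
    moreover have "eventually (\<lambda>n. \<theta> * real n > 3) sequentially"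
      unfolding b_def using \<delta> \<theta> \<epsilon> by real_asymp
    moreover have "eventually (\<lambda>n. (b n + 1) * (4 * real n * ln (real n) + 1) \<le> real n * (real n - 1) / 2) sequentially"
      unfolding b_def using \<delta> \<theta> \<epsilon> by real_asymp
    ultimately show ?thesis
    proof eventually_elim
      case (elim n)
      have "0 \<le> (1 + \<epsilon>) * ln (ln (real n))" using \<epsilon> elim(3) by simp
      note ab = rounding_bounds[of a "\<lambda>n. (1 + \<epsilon>) * ln (ln (real n))", OF a this]
      have lb: "(1 + \<delta>) * ln (ln (real n)) \<le> real (a n)"
        using ab(1) elim(2) by (simp add: \<delta>_def algebra_simps)
      moreover have "1 * 1 \<le> (1 + \<delta>) * ln (ln (real n))" using elim(3) \<delta> by (intro mult_mono) auto
      ultimately have "1 \<le> a n" by linarith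
      then show ?case
        using lb ab(2) elim by (intro prob_maker_loses_le_explicit[OF S \<delta> \<theta>_def]) (auto simp: b_def)
    qed
  qed
  moreover have "?bound \<longlonglongrightarrow> 0"
  proof -
    have 1: "(\<lambda>n. exp (- (1 + \<delta> / 2) * ln (ln (real n)))
      * (2 * ((b n + 1) * (4 * real n * ln (real n) + 1)) / (\<theta> * real n - 3))) \<longlonglongrightarrow> 0"
      unfolding b_def using \<delta> \<theta> \<epsilon> by real_asymp
    have 2: "(\<lambda>n. 2 ^ k / real n) \<longlonglongrightarrow> 0" by real_asymp
    show ?thesis
      using tendsto_add[OF 2 tendsto_mult_right[OF 1, of "1 / \<theta> ^ k"]] by simp
  qed
  ultimately have "?fail \<longlonglongrightarrow> 0"
    by (rule tendsto_sandwich[OF always_eventually[rule_format, OF measure_nonneg] _ tendsto_const])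
  then have "(\<lambda>n. 1 - ?fail n) \<longlonglongrightarrow> 1 - 0" by (intro tendsto_diff tendsto_const)
  then show ?thesis by (simp add: maker_wins_aas_def prob_Collect_not)
qed

section \<open>A Breaker who isolates a vertex\<close>

definition untouched :: "nat \<Rightarrow> nat \<Rightarrow> history \<Rightarrow> nat set" where
  "untouched n a h = {v. v < n \<and> maker_degree a h v = 0}"

lemma finite_untouched [simp]: "finite (untouched n a h)"
  by (simp add: untouched_def)

lemma untouched_snoc:
  assumes "e \<in> free_edges n h"
  shows "untouched n a (h @ [e]) =
    (if maker_to_move a (length h) then untouched n a h - e else untouched n a h)"
  using assms by (auto simp: untouched_def maker_degree_snoc)

lemma untouched_Nil [simp]: "untouched n a [] = {..<n}"
  by (auto simp: untouched_def)

lemma card_edges_meeting_le: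
  assumes "A \<subseteq> {..<n}"
  shows "card {e \<in> free_edges n h. e \<inter> A \<noteq> {}} \<le> card A * n"
proof -
  have fin: "finite A" using assms finite_subset by blast
  have "{e \<in> free_edges n h. e \<inter> A \<noteq> {}} \<subseteq> (\<Union>v\<in>A. {e \<in> free_edges n h. v \<in> e})" by auto
  then have "card {e \<in> free_edges n h. e \<inter> A \<noteq> {}} \<le> card (\<Union>v\<in>A. {e \<in> free_edges n h. v \<in> e})"
    using fin by (intro card_mono) auto
  also have "\<dots> \<le> (\<Sum>v\<in>A. free_degree n h v)"
    unfolding free_degree_def using fin by (rule card_UN_le)
  also have "\<dots> \<le> card A * n"
    using sum_bounded_above[of A "free_degree n h" n] free_degree_less assms
    by (fastforce simp: subset_iff intro: order_trans)
  finally show ?thesis .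
qed

text \<open>
  A Maker edge touches at most two vertices. The factor \<open>1 + 4 / U\<close> bounds the growth of
  \<open>1 / (U + 1)\<close> when this happens, and the probability that it happens is proportional to
  \<open>U\<close>, so that \<open>U\<close> cancels in the expected growth.
\<close>

lemma inverse_count_le:
  assumes "U \<le> U' + 2"
  shows "1 / (real U' + 1) \<le> (1 + 4 / real U) / (real U + 1)"
proof -
  consider "U = 0" | "U = 1" | "2 \<le> U" by linarith
  then show ?thesis
  proof cases
    case 3
    have "real U * (real U + 1) \<le> (real U + 4) * (real U - 1)" using 3 by (simp add: algebra_simps)
    also have "\<dots> \<le> (real U + 4) * (real U' + 1)" using assms by (intro mult_left_mono) auto
    finally have "1 \<le> (real U + 4) * (real U' + 1) / (real U * (real U + 1))" using 3 by simp
    also have "\<dots> = (1 + 4 / real U) / (real U + 1) * (real U' + 1)" using 3 by (simp add: add_divide_eq_iff)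
    finally show ?thesis by (simp add: pos_divide_le_eq)
  qed (auto simp: field_simps)
qed

text \<open>
  This replaces a second moment argument for the coupon collector, and it is insensitive to
  Breaker's moves. For the number \<open>U\<close> of untouched vertices, \<open>1 / (U + 1)\<close> grows in expectation
  by a factor of at most \<open>1 + 4 n / F\<^sub>0\<close> per move, from \<open>1 / (n + 1)\<close> at the start, and it
  equals \<open>1\<close> once no untouched vertex is left.
\<close>

lemma (in half_random) prob_all_touched_le:
  assumes t: "t \<le> card (complete_edges n)"
    and F\<^sub>0: "0 < F\<^sub>0" "F\<^sub>0 + real t \<le> card (complete_edges n)"
  shows "measure_pmf.prob (play n a S t) {h. untouched n a h = {}}
    \<le> (1 + 4 * real n / F\<^sub>0) ^ t / (real n + 1)"
proof -
  define \<kappa> where "\<kappa> = 1 + 4 * real n / F\<^sub>0"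
  have \<kappa>: "1 \<le> \<kappa>" using F\<^sub>0 by (simp add: \<kappa>_def)
  define U where "U h = card (untouched n a h)" for h
  define \<Phi> where "\<Phi> h = 1 / (\<kappa> ^ length h * (real (U h) + 1))" for h
  have nn: "0 \<le> \<Phi> h" for h using \<kappa> by (simp add: \<Phi>_def)
  have "measure_pmf.expectation (play n a S t) \<Phi> \<le> \<Phi> []"
  proof (rule expectation_le_initial[OF t])
    fix h assume h: "legal n h" "length h < t" "maker_to_move a (length h)"
    let ?F = "real (card (free_edges n h))"
    let ?T = "{e \<in> free_edges n h. e \<inter> untouched n a h \<noteq> {}}"
    have F: "F\<^sub>0 \<le> ?F" using F\<^sub>0(2) h card_free_edges[OF h(1)] t by simp
    have each: "\<Phi> (h @ [e]) \<le> \<Phi> h / \<kappa> * (1 + (if e \<in> ?T then 4 / real (U h) else 0))"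
      if e: "e \<in> free_edges n h" for e
    proof -
      have "1 / (real (U (h @ [e])) + 1) \<le> (1 + (if e \<in> ?T then 4 / real (U h) else 0)) / (real (U h) + 1)"
      proof (cases "e \<in> ?T")
        case True
        have "card e = 2" "finite e"
          using e by (auto simp: free_edges_def complete_edges_def intro: card_ge_0_finite)
        then have "U h \<le> U (h @ [e]) + 2"
          using h(3) e diff_card_le_card_Diff[of e "untouched n a h"] by (simp add: U_def untouched_snoc)
        then show ?thesis using True inverse_count_le by simp
      next
        case False
        then have "untouched n a h - e = untouched n a h" using e by auto
        then show ?thesis using False h(3) e by (simp add: U_def untouched_snoc)
      qed
      then have "1 / (real (U (h @ [e])) + 1) / \<kappa> ^ Suc (length h)
          \<le> (1 + (if e \<in> ?T then 4 / real (U h) else 0)) / (real (U h) + 1) / \<kappa> ^ Suc (length h)"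
        using \<kappa> by (intro divide_right_mono) auto
      then show ?thesis by (simp add: \<Phi>_def mult_ac)
    qed
    have "(\<Sum>e\<in>free_edges n h. \<Phi> (h @ [e]))
        \<le> (\<Sum>e\<in>free_edges n h. \<Phi> h / \<kappa> * (1 + (if e \<in> ?T then 4 / real (U h) else 0)))"
      using each by (rule sum_mono)
    also have "\<dots> = \<Phi> h / \<kappa> * (?F + (\<Sum>e\<in>free_edges n h. if e \<in> ?T then 4 / real (U h) else 0))"
      by (simp only: sum_distrib_left[symmetric] sum.distrib) simp
    also have "(\<Sum>e\<in>free_edges n h. if e \<in> ?T then 4 / real (U h) else 0) = real (card ?T) * (4 / real (U h))"
      by (subst sum.inter_filter[symmetric]) auto
    also have "\<Phi> h / \<kappa> * (?F + real (card ?T) * (4 / real (U h))) \<le> \<Phi> h / \<kappa> * (?F * \<kappa>)"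
    proof (intro mult_left_mono)
      have "untouched n a h \<subseteq> {..<n}" by (auto simp: untouched_def)
      then have "real (card ?T) \<le> real (U h * n)"
        unfolding U_def of_nat_le_iff by (rule card_edges_meeting_le)
      then have "real (card ?T) * (4 / real (U h)) \<le> real (U h * n) * (4 / real (U h))"
        by (intro mult_right_mono) auto
      also have "\<dots> \<le> 4 * real n" by simp
      also have "\<dots> = F\<^sub>0 * (4 * real n / F\<^sub>0)" using F\<^sub>0 by simp
      also have "\<dots> \<le> ?F * (4 * real n / F\<^sub>0)" using F F\<^sub>0 by (intro mult_right_mono) auto
      finally show "?F + real (card ?T) * (4 / real (U h)) \<le> ?F * \<kappa>" by (simp add: \<kappa>_def algebra_simps)
      show "0 \<le> \<Phi> h / \<kappa>" using nn \<kappa> by simp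
    qed
    also have "\<dots> = ?F * \<Phi> h" using \<kappa> by simp
    finally show "(\<Sum>e\<in>free_edges n h. \<Phi> (h @ [e])) \<le> ?F * \<Phi> h" .
  next
    fix h assume h: "\<not> maker_to_move a (length h)" "S h \<in> free_edges n h"
    have "\<Phi> (h @ [S h]) = \<Phi> h / \<kappa>" using h by (simp add: \<Phi>_def U_def untouched_snoc)
    also have "\<dots> \<le> \<Phi> h" using nn[of h] \<kappa> by (simp add: divide_le_eq mult_le_cancel_left1)
    finally show "\<Phi> (h @ [S h]) \<le> \<Phi> h" .
  qed
  also have "\<Phi> [] = 1 / (real n + 1)" by (simp add: \<Phi>_def U_def)
  finally have E: "measure_pmf.expectation (play n a S t) \<Phi> \<le> 1 / (real n + 1)" .
  have "1 / \<kappa> ^ t * measure_pmf.prob (play n a S t) {h. untouched n a h = {}}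
      \<le> measure_pmf.expectation (play n a S t) \<Phi>"
    using nn by (intro markov_play t) (auto simp: \<Phi>_def U_def)
  with E have "1 / \<kappa> ^ t * measure_pmf.prob (play n a S t) {h. untouched n a h = {}} \<le> 1 / (real n + 1)"
    by linarith
  then show ?thesis using \<kappa> unfolding \<kappa>_def[symmetric] by (simp add: field_simps)
qed

text \<open>
  Choosing the least untouched vertex lets the target depend on the current position alone, while
  it still changes only when Maker touches it.
\<close>

definition target :: "nat \<Rightarrow> nat \<Rightarrow> history \<Rightarrow> nat" where
  "target n a h = (LEAST v. v \<in> untouched n a h)"

definition isolating_breaker :: "nat \<Rightarrow> nat \<Rightarrow> strategy" where
  "isolating_breaker n a h =
     (if \<exists>e\<in>free_edges n h. target n a h \<in> e
      then SOME e. e \<in> free_edges n h \<and> target n a h \<in> e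
      else SOME e. e \<in> free_edges n h)"

lemma isolating_breaker_hits_target:
  assumes "free_degree n h (target n a h) > 0"
  shows "isolating_breaker n a h \<in> free_edges n h \<and> target n a h \<in> isolating_breaker n a h"
proof -
  have ex: "\<exists>e. e \<in> free_edges n h \<and> target n a h \<in> e"
    using assms unfolding free_degree_def card_gt_0_iff by blast
  then show ?thesis using someI_ex[OF ex] by (auto simp: isolating_breaker_def)
qed

lemma breaker_strategy_isolating: "breaker_strategy n a (isolating_breaker n a)"
  unfolding breaker_strategy_def
proof (intro allI impI)
  fix h assume "distinct h \<and> set h \<subseteq> complete_edges n \<and> free_edges n h \<noteq> {}
    \<and> \<not> maker_to_move a (length h)"
  then have ex: "\<exists>e. e \<in> free_edges n h" by auto
  show "isolating_breaker n a h \<in> free_edges n h"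
  proof (cases "\<exists>e\<in>free_edges n h. target n a h \<in> e")
    case True
    then have "free_degree n h (target n a h) > 0" using free_degree_pos by blast
    then show ?thesis using isolating_breaker_hits_target by blast
  next
    case False
    then show ?thesis using someI_ex[OF ex] by (simp add: isolating_breaker_def)
  qed
qed

lemma target_in_untouched: "untouched n a h \<noteq> {} \<Longrightarrow> target n a h \<in> untouched n a h"
  unfolding target_def using LeastI_ex[of "\<lambda>v. v \<in> untouched n a h"] by blast

lemma target_snoc:
  assumes "e \<in> free_edges n h" "untouched n a h \<noteq> {}" "maker_to_move a (length h) \<Longrightarrow> target n a h \<notin> e"
  shows "target n a (h @ [e]) = target n a h" "untouched n a (h @ [e]) \<noteq> {}"
proof -
  have t: "target n a h \<in> untouched n a (h @ [e])"
    using assms target_in_untouched by (simp add: untouched_snoc)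
  then show "untouched n a (h @ [e]) \<noteq> {}" by blast
  have sub: "untouched n a (h @ [e]) \<subseteq> untouched n a h" using assms by (auto simp: untouched_snoc)
  have "(LEAST v. v \<in> untouched n a (h @ [e])) = target n a h"
  proof (rule Least_equality)
    show "target n a h \<in> untouched n a (h @ [e])" by (rule t)
    fix y assume "y \<in> untouched n a (h @ [e])"
    then show "target n a h \<le> y" using sub unfolding target_def by (intro Least_le) auto
  qed
  then show "target n a (h @ [e]) = target n a h" by (simp add: target_def[of n a "h @ [e]"])
qed

text \<open>
  If Breaker concentrates on a vertex with \<open>r\<close> free edges, and a round with \<open>i\<close> free edges there
  leaves it untouched with probability \<open>exp (- b i)\<close>, then \<open>exp (- b r (r + 1) / 2)\<close> is the
  probability that it becomes isolated. The linear term charges every round of an attack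
  \<open>p / n\<close>; since \<open>p\<close> is the success probability from \<open>r = n\<close>, the net value stays nonnegative.
  The charge is what makes the probability that all attacks fail decay by the factor
  \<open>1 - p / (2 n)\<close> per round.
\<close>

definition attack :: "real \<Rightarrow> nat \<Rightarrow> real \<Rightarrow> nat \<Rightarrow> real" where
  "attack b n p r = exp (- b * (real r * (real r + 1) / 2)) - p * real r / real n"

lemma attack_bounds:
  assumes "0 \<le> b" "r \<le> n" "0 < n" "p = exp (- b * (real n * (real n + 1) / 2))"
  shows "0 \<le> attack b n p r" "attack b n p r \<le> 1"
proof -
  have "p * (real r / real n) \<le> p * 1" using assms by (intro mult_left_mono) auto
  also have "p * 1 \<le> exp (- b * (real r * (real r + 1) / 2))"
    using assms by (auto intro!: mult_left_mono mult_mono)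
  finally show "0 \<le> attack b n p r" by (simp add: attack_def)
  have "exp (- b * (real r * (real r + 1) / 2)) \<le> 1" using assms(1) by simp
  moreover have "0 \<le> p * real r / real n" using assms by simp
  ultimately show "attack b n p r \<le> 1" unfolding attack_def by linarith
qed

lemma attack_step:
  assumes "0 \<le> b" "0 < r" "r \<le> n" "p = exp (- b * (real n * (real n + 1) / 2))"
  shows "1 - exp (- b * real r) * attack b n p (r - 1) / 2
    \<le> (1 - p / (2 * real n)) * (1 - attack b n p r / 2)"
proof -
  obtain q where q: "r = Suc q" using assms(2) by (cases r) auto
  have n: "0 < n" using assms by simp
  have E: "exp (- b * real r) * exp (- b * (real q * (real q + 1) / 2)) = exp (- b * (real r * (real r + 1) / 2))"
    unfolding exp_add[symmetric] by (rule arg_cong[of _ _ exp]) (simp add: q field_simps)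
  have "exp (- b * real r) * (p * real q / real n) \<le> 1 * (p * real q / real n)"
    using assms(1,4) by (intro mult_right_mono) auto
  moreover have "attack b n p r = exp (- b * (real r * (real r + 1) / 2)) - p * real q / real n - p / real n"
    by (simp add: attack_def q algebra_simps add_divide_distrib)
  moreover have "exp (- b * real r) * attack b n p (r - 1)
      = exp (- b * (real r * (real r + 1) / 2)) - exp (- b * real r) * (p * real q / real n)"
    unfolding E[symmetric] by (simp add: attack_def q right_diff_distrib)
  ultimately have "attack b n p r + p / real n \<le> exp (- b * real r) * attack b n p (r - 1)"
    by linarith
  then have "1 - exp (- b * real r) * attack b n p (r - 1) / 2 \<le> 1 - attack b n p r / 2 - p / (2 * real n)"
    by simp
  also have "\<dots> \<le> (1 - p / (2 * real n)) * (1 - attack b n p r / 2)"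
    using attack_bounds(1)[OF assms(1,3) n assms(4)] assms(4) by (simp add: algebra_simps)
  finally show ?thesis .
qed

text \<open>
  The potential \<open>\<Psi>\<close> below bounds the failure probability, divided by \<open>\<mu> ^ i\<close> after \<open>i\<close> rounds
  with \<open>\<mu> = 1 - p / (2 n)\<close>. A new target is worth at most \<open>1\<close>, a target with \<open>r\<close> free edges
  and \<open>j\<close> Maker moves already made in the round is worth \<open>V r j \<le> 1\<close>, and an isolated one is
  worth \<open>0\<close>. Maker's moves do not increase \<open>\<Psi>\<close> in expectation because \<open>V\<close> discounts the
  success probability by the chance of a hit; Breaker's move gains the factor \<open>\<mu>\<close> that
  pays for the round. Halving the value of an attack keeps \<open>V \<ge> 1 / 2\<close> as long as the target is not
  yet isolated, so that running out of time has probability at most \<open>2 \<mu> ^ R\<close>. When no untouched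
  vertex is left \<open>\<Psi>\<close> is \<open>0\<close>: that event is estimated separately.
\<close>

lemma prob_isolation_fails_le:
  assumes n: "0 < n" and s: "0 \<le> s" "\<And>x. 0 \<le> x \<Longrightarrow> x \<le> real n / F\<^sub>0 \<Longrightarrow> exp (- s * x) \<le> 1 - x"
    and t: "t = (a + 1) * R" "t \<le> card (complete_edges n)"
    and F\<^sub>0: "0 < F\<^sub>0" "F\<^sub>0 + real t \<le> card (complete_edges n)"
    and p: "p = exp (- (s * real a / F\<^sub>0) * (real n * (real n + 1) / 2))"
  shows "measure_pmf.prob (play n a (isolating_breaker n a) t)
      {h. untouched n a h \<noteq> {} \<and> 0 < free_degree n h (target n a h)}
    \<le> 2 * (1 - p / (2 * real n)) ^ R"
proof -
  let ?S = "isolating_breaker n a"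
  interpret half_random n a ?S by standard (rule breaker_strategy_isolating)
  define b where "b = s * real a / F\<^sub>0"
  define g where "g = attack b n p"
  define \<mu> where "\<mu> = 1 - p / (2 * real n)"
  define V where "V r j = 1 - exp (- s * (real a - real j) * real r / F\<^sub>0) * g (r - 1) / 2" for r j :: nat
  define open_target where "open_target h \<longleftrightarrow> untouched n a h \<noteq> {} \<and> 0 < free_degree n h (target n a h)" for h
  define \<Psi> where "\<Psi> h = (if open_target h
      then V (free_degree n h (target n a h)) (length h mod (a + 1)) / \<mu> ^ (length h div (a + 1)) else 0)" for h
  have b0: "0 \<le> b" using s F\<^sub>0 by (simp add: b_def)
  have pb: "p = exp (- b * (real n * (real n + 1) / 2))" by (simp add: p b_def)
  have p1: "0 < p" "p \<le> 1" using b0 by (auto simp: pb)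
  have \<mu>: "0 < \<mu>" "\<mu> \<le> 1" using p1 n by (auto simp: \<mu>_def field_simps)
  have g: "0 \<le> g r" "g r \<le> 1" if "r \<le> n" for r
    using attack_bounds[OF b0 that n pb] by (auto simp: g_def)
  have V: "1 / 2 \<le> V r j" "V r j \<le> 1" if "r \<le> n" "j \<le> a" for r j
  proof -
    have "0 \<le> s * (real a - real j) * real r / F\<^sub>0" using that s F\<^sub>0 by simp
    then have "exp (- s * (real a - real j) * real r / F\<^sub>0) * g (r - 1) \<le> 1 * 1"
      using that g[of "r - 1"] by (intro mult_mono) auto
    then show "1 / 2 \<le> V r j" by (simp add: V_def)
    show "V r j \<le> 1" using g[of "r - 1"] that by (simp add: V_def)
  qed
  have j: "length h mod (a + 1) \<le> a" for h :: history
    using mod_less_divisor[of "a + 1" "length h"] by linarith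
  have deg: "free_degree n h (target n a h) \<le> n" if "untouched n a h \<noteq> {}" for h
    using free_degree_less[of "target n a h" n h] target_in_untouched[OF that] by (simp add: untouched_def)
  have \<Psi>_le: "\<Psi> h \<le> 1 / \<mu> ^ (length h div (a + 1))" for h
    using V(2)[OF deg j] \<mu> by (auto simp: \<Psi>_def open_target_def divide_right_mono)
  have \<Psi>_nn: "0 \<le> \<Psi> h" for h
  proof -
    have "0 \<le> V (free_degree n h (target n a h)) (length h mod (a + 1))" if "open_target h"
      using V(1)[OF deg j, of h h] that by (simp add: open_target_def)
    then show ?thesis using \<mu> by (simp add: \<Psi>_def)
  qed
  have "measure_pmf.expectation (play n a ?S t) \<Psi> \<le> \<Psi> []"
  proof (rule expectation_le_initial[OF t(2)])
    fix h assume h: "legal n h" "length h < t" "maker_to_move a (length h)"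
    let ?F = "real (card (free_edges n h))" and ?i = "length h div (a + 1)" and ?j = "length h mod (a + 1)"
    let ?v = "target n a h" let ?r = "free_degree n h ?v"
    show "(\<Sum>e\<in>free_edges n h. \<Psi> (h @ [e])) \<le> ?F * \<Psi> h"
    proof (cases "open_target h")
      case True
      have ne: "untouched n a h \<noteq> {}" using True by (simp add: open_target_def)
      note next_phase = Suc_mod_maker[OF h(3)]
      have F: "F\<^sub>0 \<le> ?F" using F\<^sub>0(2) h card_free_edges[OF h(1)] t(2) by simp
      have "(\<Sum>e\<in>free_edges n h. \<Psi> (h @ [e]))
          \<le> ?r * (1 / \<mu> ^ ?i) + (?F - ?r) * (V ?r (Suc ?j) / \<mu> ^ ?i)"
      proof (rule sum_free_edges_split)
        fix e
        show "\<Psi> (h @ [e]) \<le> 1 / \<mu> ^ ?i" using \<Psi>_le[of "h @ [e]"] next_phase by simp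
        assume e: "e \<in> free_edges n h" "?v \<notin> e"
        then show "\<Psi> (h @ [e]) \<le> V ?r (Suc ?j) / \<mu> ^ ?i"
          using target_snoc[OF e(1) ne] True next_phase
          by (simp add: \<Psi>_def open_target_def free_degree_snoc)
      qed
      also have "\<dots> = (?r + (?F - ?r) * V ?r (Suc ?j)) / \<mu> ^ ?i" by (simp add: add_divide_distrib)
      also have "\<dots> \<le> (?F * V ?r ?j) / \<mu> ^ ?i"
      proof (intro divide_right_mono)
        \<comment> \<open>\<open>E\<close> is the chance that the target survives Maker's remaining moves of this round after the
          present one; the present move contributes the factor \<open>exp (- s r / F\<^sub>0)\<close>.\<close>
        define E where "E = exp (- s * (real a - real (Suc ?j)) * real ?r / F\<^sub>0)"
        have E: "exp (- s * (real a - real ?j) * real ?r / F\<^sub>0) = exp (- s * (?r / F\<^sub>0)) * E"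
          unfolding E_def exp_add[symmetric] using F\<^sub>0 by (simp add: field_simps)
        have gg: "0 \<le> E * g (?r - 1)" using g(1)[of "?r - 1"] deg[OF ne] by (simp add: E_def)
        have "?F * exp (- s * (?r / F\<^sub>0)) \<le> ?F * (1 - ?r / F\<^sub>0)"
          using s(2)[of "?r / F\<^sub>0"] F\<^sub>0 deg[OF ne] by (intro mult_left_mono) (auto simp: divide_right_mono)
        also have "\<dots> \<le> ?F - ?r"
        proof -
          have "?r / F\<^sub>0 * F\<^sub>0 \<le> ?r / F\<^sub>0 * ?F" using F F\<^sub>0 by (intro mult_left_mono) auto
          then show ?thesis using F\<^sub>0 by (simp add: algebra_simps)
        qed
        finally have "?F * exp (- s * (?r / F\<^sub>0)) * (E * g (?r - 1)) \<le> (?F - ?r) * (E * g (?r - 1))"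
          using gg by (rule mult_right_mono)
        then show "?r + (?F - ?r) * V ?r (Suc ?j) \<le> ?F * V ?r ?j"
          unfolding V_def E E_def[symmetric] by (simp add: algebra_simps)
      qed (use \<mu> in auto)
      finally show ?thesis using True by (simp add: \<Psi>_def)
    next
      case False
      have "\<Psi> (h @ [e]) = 0" if e: "e \<in> free_edges n h" for e
      proof (cases "untouched n a h = {}")
        case True
        then show ?thesis using e by (simp add: \<Psi>_def open_target_def untouched_snoc)
      next
        case ne: False
        then have "?v \<notin> e" using False ne free_degree_pos[OF e, of ?v] by (auto simp: open_target_def)
        then show ?thesis using target_snoc[OF e ne] False ne e
          by (simp add: \<Psi>_def open_target_def free_degree_snoc)
      qed
      then show ?thesis using \<Psi>_nn by simp
    qed
  next
    fix h assume h: "legal n h" "length h < t" "\<not> maker_to_move a (length h)" "?S h \<in> free_edges n h"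
    let ?i = "length h div (a + 1)" let ?v = "target n a h" let ?r = "free_degree n h ?v"
    note next_phase = Suc_mod_breaker[OF h(3)]
    show "\<Psi> (h @ [?S h]) \<le> \<Psi> h"
    proof (cases "open_target (h @ [?S h])")
      case True
      then have ne: "untouched n a h \<noteq> {}" using h(3,4) by (simp add: open_target_def untouched_snoc)
      note same = target_snoc(1)[OF h(4) ne]
      have pos: "0 < ?r"
        using True same h(3,4) by (auto simp: open_target_def free_degree_snoc split: if_splits)
      then have hit: "?v \<in> ?S h" using isolating_breaker_hits_target by blast
      have r1: "0 < ?r - 1" using True same h(3,4) hit by (simp add: open_target_def free_degree_snoc)
      have "\<Psi> (h @ [?S h]) = V (?r - 1) 0 / \<mu> ^ Suc ?i"
        using True same h(3,4) hit next_phase by (simp add: \<Psi>_def free_degree_snoc)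
      also have "\<dots> \<le> (\<mu> * V ?r a) / \<mu> ^ Suc ?i"
      proof (intro divide_right_mono)
        show "V (?r - 1) 0 \<le> \<mu> * V ?r a"
          using attack_step[OF b0 r1 _ pb] deg[OF ne]
          by (simp add: V_def g_def \<mu>_def b_def)
      qed (use \<mu> in auto)
      also have "\<dots> = \<Psi> h" using \<mu> pos ne next_phase by (simp add: \<Psi>_def open_target_def)
      finally show ?thesis .
    next
      case False
      then have "\<Psi> (h @ [?S h]) = 0" by (simp add: \<Psi>_def)
      then show ?thesis using \<Psi>_nn by simp
    qed
  qed
  also have "\<Psi> [] \<le> 1" using \<Psi>_le[of "[]"] by simp
  finally have E: "measure_pmf.expectation (play n a ?S t) \<Psi> \<le> 1" .
  have "1 / 2 / \<mu> ^ R * measure_pmf.prob (play n a ?S t) {h. open_target h}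
      \<le> measure_pmf.expectation (play n a ?S t) \<Psi>"
  proof (intro markov_play t(2) \<Psi>_nn)
    fix h assume h: "length h = t" "h \<in> {h. open_target h}"
    have "length h div (a + 1) = R"
      unfolding h(1) t(1) by (intro nonzero_mult_div_cancel_left) simp
    then have "\<Psi> h = V (free_degree n h (target n a h)) (length h mod (a + 1)) / \<mu> ^ R"
      using h(2) by (simp add: \<Psi>_def)
    also have "\<dots> \<ge> 1 / 2 / \<mu> ^ R"
      using h(2) V(1)[OF deg j, of h h] \<mu> by (intro divide_right_mono) (auto simp: open_target_def)
    finally show "1 / 2 / \<mu> ^ R \<le> \<Psi> h" .
  qed
  with E have "1 / 2 / \<mu> ^ R * measure_pmf.prob (play n a ?S t) {h. open_target h} \<le> 1" by linarith
  then show ?thesis using \<mu> unfolding \<mu>_def[symmetric] open_target_def by (simp add: field_simps)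
qed

text \<open>
  A vertex without free edges can no longer be touched, so Breaker's success can be read off from
  the position at time \<open>t\<close>.
\<close>

lemma isolated_vertex_stays_isolated:
  assumes "legal n h" "v \<in> untouched n a (take t h)" "free_degree n (take t h) v = 0"
  shows "maker_degree a h v = 0"
proof -
  have "v \<notin> e" if e: "e \<in> maker_edges a h" for e
  proof
    assume v: "v \<in> e"
    obtain i where i: "e = h ! i" "i < length h" "maker_to_move a i"
      using e by (auto simp: maker_edges_def)
    show False
    proof (cases "i < t")
      case True
      then have "take t h ! i = e" "i < length (take t h)" using i by auto
      then have "e \<in> maker_edges a (take t h)" using i(3) by (force simp: maker_edges_def)
      then have "{e' \<in> maker_edges a (take t h). v \<in> e'} \<noteq> {}" using v by blast
      then show False
        using assms(2) by (auto simp: untouched_def maker_degree_def degree_in_def)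
    next
      case False
      have "e \<notin> set (take t h)"
        using assms(1) i False by (auto simp: legal_def in_set_conv_nth nth_eq_iff_index_eq)
      moreover have "e \<in> complete_edges n" using assms(1) i by (auto simp: legal_def)
      ultimately have "e \<in> free_edges n (take t h)" by (simp add: free_edges_def)
      then show False using free_degree_pos v assms(3) by (metis less_irrefl)
    qed
  qed
  then have "{e \<in> maker_edges a h. v \<in> e} = {}" by auto
  then show ?thesis by (simp add: maker_degree_def degree_in_def)
qed

lemma prob_maker_wins_le:
  assumes n: "0 < n" and k: "0 < k"
    and s: "0 \<le> s" "\<And>x. 0 \<le> x \<Longrightarrow> x \<le> real n / F\<^sub>0 \<Longrightarrow> exp (- s * x) \<le> 1 - x"
    and t: "t = (a + 1) * R" and F\<^sub>0: "0 < F\<^sub>0" "F\<^sub>0 + real t \<le> card (complete_edges n)"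
    and p: "p = exp (- (s * real a / F\<^sub>0) * (real n * (real n + 1) / 2))"
  shows "measure_pmf.prob (half_random_game n a (isolating_breaker n a))
      {h. min_degree_game k n (maker_edges a h)}
    \<le> (1 + 4 * real n / F\<^sub>0) ^ t / (real n + 1) + 2 * (1 - p / (2 * real n)) ^ R"
proof -
  let ?S = "isolating_breaker n a" and ?N = "card (complete_edges n)"
  interpret half_random n a ?S by standard (rule breaker_strategy_isolating)
  let ?A = "\<lambda>h. untouched n a h = {}"
  let ?B = "\<lambda>h. untouched n a h \<noteq> {} \<and> 0 < free_degree n h (target n a h)"
  have tN: "t \<le> ?N" using F\<^sub>0 by linarith
  have "?A (take t h) \<or> ?B (take t h)"
    if "h \<in> set_pmf (play n a ?S ?N)" "min_degree_game k n (maker_edges a h)" for h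
  proof (rule ccontr)
    assume not: "\<not> (?A (take t h) \<or> ?B (take t h))"
    let ?v = "target n a (take t h)"
    have v: "?v \<in> untouched n a (take t h)" using not target_in_untouched by blast
    have "maker_degree a h ?v = 0"
      using isolated_vertex_stays_isolated[OF _ v] not play_legal[OF order.refl that(1)] by blast
    then show False using that(2) v n k by (auto simp: min_degree_game_iff untouched_def)
  qed
  then have "measure_pmf.prob (play n a ?S ?N) {h. min_degree_game k n (maker_edges a h)}
      \<le> measure_pmf.prob (play n a ?S ?N) ({h. ?A (take t h)} \<union> {h. ?B (take t h)})"
    by (intro measure_pmf.finite_measure_mono_AE) (auto simp: AE_measure_pmf_iff)
  also have "\<dots> \<le> measure_pmf.prob (play n a ?S ?N) {h. ?A (take t h)}
      + measure_pmf.prob (play n a ?S ?N) {h. ?B (take t h)}"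
    by (intro measure_Un_le) auto
  also have "\<dots> = measure_pmf.prob (play n a ?S t) {h. ?A h} + measure_pmf.prob (play n a ?S t) {h. ?B h}"
    using prob_take[OF tN order.refl, of ?A] prob_take[OF tN order.refl, of ?B] by simp
  also have "\<dots> \<le> (1 + 4 * real n / F\<^sub>0) ^ t / (real n + 1) + 2 * (1 - p / (2 * real n)) ^ R"
    using prob_all_touched_le[OF tN F\<^sub>0] prob_isolation_fails_le[OF n s t tN F\<^sub>0 p] by linarith
  finally show ?thesis by (simp add: half_random_game_def)
qed

section \<open>Bias below the threshold\<close>

lemma exp_minus_le_one_minus:
  fixes x \<theta> :: real
  assumes "0 < \<theta>" "0 \<le> x" "x \<le> \<theta> / (1 + \<theta>)"
  shows "exp (- (1 + \<theta>) * x) \<le> 1 - x"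
proof -
  have "(1 + \<theta>) * x \<le> \<theta>" using assms by (simp add: field_simps)
  then have "x * ((1 + \<theta>) * x) \<le> x * \<theta>" using assms by (intro mult_left_mono) auto
  then have "1 \<le> (1 - x) * (1 + (1 + \<theta>) * x)" by (simp add: algebra_simps)
  also have "\<dots> \<le> (1 - x) * exp ((1 + \<theta>) * x)"
  proof (intro mult_left_mono exp_ge_add_one_self)
    have "\<theta> / (1 + \<theta>) \<le> 1" using assms(1) by simp
    then show "0 \<le> 1 - x" using assms(3) by linarith
  qed
  finally have "1 / exp ((1 + \<theta>) * x) \<le> 1 - x" by (simp add: pos_divide_le_eq)
  then show ?thesis by (simp only: mult_minus_left exp_minus inverse_eq_divide)
qed

text \<open>
  The parameters of the attack. After \<open>n ln n / 32\<close> moves the first error term is only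
  \<open>exp (ln n / 2) / n\<close>, and at least \<open>F\<^sub>0 = (1 - o(1)) n\<^sup>2 / 2\<close> edges are still free. The slack
  \<open>\<beta> / 4\<close> enters twice, through \<open>1 - x \<ge> exp (- (1 + \<beta> / 4) x)\<close> and through the
  lower order terms of \<open>n (n + 1) / (2 F\<^sub>0)\<close>; since
  \<open>(1 + \<beta> / 4)\<^sup>2 (1 - \<beta>) \<le> 1 - \<beta> / 2\<close>, an attack succeeds with probability
  of order at least \<open>(ln n) powr (\<beta> / 2 - 1)\<close>, which beats the
  \<open>ln n / ln (ln n)\<close> attacks, up to a constant, that fit into the available time.
\<close>

lemma prob_maker_wins_le_explicit:
  fixes n a k :: nat
  defines "L \<equiv> ln (ln (real n))"
    and "F\<^sub>0 \<equiv> real n * (real n - 1) / 2 - real n * ln (real n) / 32"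
  assumes k: "0 < k" and \<beta>: "0 < \<beta>" "\<beta> < 1" and a: "real a \<le> (1 - \<beta>) * L"
    and n: "0 < n" "1 \<le> ln (real n)"
    and big: "real n * real n / 4 \<le> F\<^sub>0" "real n * (real n + 1) / 2 \<le> (1 + \<beta> / 4) * F\<^sub>0"
      "real n / F\<^sub>0 \<le> \<beta> / 4 / (1 + \<beta> / 4)"
  shows "measure_pmf.prob (half_random_game n a (isolating_breaker n a))
      {h. min_degree_game k n (maker_edges a h)}
    \<le> exp (ln (real n) / 2) / real n
      + 2 * exp (- (exp (- (1 - \<beta> / 2) * L) * (real n * ln (real n) / (32 * ((1 - \<beta>) * L + 1)) - 1)
          / (2 * real n)))"
proof -
  define R where "R = nat \<lfloor>real n * ln (real n) / (32 * (real a + 1))\<rfloor>"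
  define t where "t = (a + 1) * R"
  define s where "s = 1 + \<beta> / 4"
  define p where "p = exp (- (s * real a / F\<^sub>0) * (real n * (real n + 1) / 2))"
  have "0 < real n * real n / 4" using n by simp
  then have F\<^sub>0: "0 < F\<^sub>0" using big(1) by linarith
  have "0 \<le> real n * ln (real n) / (32 * (real a + 1))" using n by simp
  then have R: "real R \<le> real n * ln (real n) / (32 * (real a + 1))"
    "real n * ln (real n) / (32 * (real a + 1)) - 1 \<le> real R"
    unfolding R_def by linarith+
  have t: "real t \<le> real n * ln (real n) / 32"
    using R(1) by (simp add: t_def field_simps)
  have N: "F\<^sub>0 + real t \<le> card (complete_edges n)"
    using t by (simp add: real_card_complete_edges F\<^sub>0_def)
  have s0: "0 \<le> s" using \<beta> by (simp add: s_def)
  have sx: "exp (- s * x) \<le> 1 - x" if "0 \<le> x" "x \<le> real n / F\<^sub>0" for x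
    unfolding s_def using that big(3) \<beta> by (intro exp_minus_le_one_minus) auto
  have L: "0 \<le> L" using n by (simp add: L_def)
  have p: "exp (- (1 - \<beta> / 2) * L) \<le> p"
  proof -
    have "real n * (real n + 1) / 2 / F\<^sub>0 \<le> s"
      using big(2) F\<^sub>0 by (simp add: s_def pos_divide_le_eq)
    then have "(s * real a) * (real n * (real n + 1) / 2 / F\<^sub>0) \<le> (s * real a) * s"
      using s0 by (intro mult_left_mono) auto
    also have "\<dots> = (s * s) * real a" by simp
    also have "\<dots> \<le> (s * s) * ((1 - \<beta>) * L)" using a s0 by (intro mult_left_mono) auto
    also have "\<dots> = (s * s * (1 - \<beta>)) * L" by simp
    also have "\<dots> \<le> (1 - \<beta> / 2) * L"
    proof (intro mult_right_mono L)
      have "1 - \<beta> / 2 - s * s * (1 - \<beta>) = \<beta>\<^sup>2 * (7 / 16 + \<beta> / 16)"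
        by (simp add: s_def power2_eq_square field_simps)
      also have "\<dots> \<ge> 0" using \<beta> by simp
      finally show "s * s * (1 - \<beta>) \<le> 1 - \<beta> / 2" by linarith
    qed
    finally have "s * real a / F\<^sub>0 * (real n * (real n + 1) / 2) \<le> (1 - \<beta> / 2) * L"
      by (simp add: mult.commute)
    then show ?thesis
      unfolding p_def exp_le_cancel_iff mult_minus_left by (rule le_imp_neg_le)
  qed
  have p1: "0 < p" "p \<le> 1" using F\<^sub>0 s0 by (auto simp: p_def)
  have "measure_pmf.prob (half_random_game n a (isolating_breaker n a))
      {h. min_degree_game k n (maker_edges a h)}
    \<le> (1 + 4 * real n / F\<^sub>0) ^ t / (real n + 1) + 2 * (1 - p / (2 * real n)) ^ R"
    by (rule prob_maker_wins_le[OF n(1) k s0 sx t_def F\<^sub>0 N p_def])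
  also have "\<dots> \<le> exp (ln (real n) / 2) / real n
      + 2 * exp (- (exp (- (1 - \<beta> / 2) * L) * (real n * ln (real n) / (32 * ((1 - \<beta>) * L + 1)) - 1)
          / (2 * real n)))"
  proof (intro add_mono mult_left_mono)
    have "4 * real n / F\<^sub>0 \<le> 4 * real n / (real n * real n / 4)"
      using big(1) F\<^sub>0 n by (intro divide_left_mono) auto
    also have "\<dots> = 16 / real n" by simp
    finally have "1 + 4 * real n / F\<^sub>0 \<le> exp (16 / real n)"
      using exp_ge_add_one_self[of "16 / real n"] by linarith
    then have "(1 + 4 * real n / F\<^sub>0) ^ t \<le> exp (16 / real n) ^ t"
      using F\<^sub>0 by (intro power_mono) auto
    also have "\<dots> = exp (real t * (16 / real n))" by (rule exp_of_nat_mult[symmetric])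
    also have "\<dots> \<le> exp (ln (real n) / 2)"
      using t n by (simp add: field_simps)
    finally show "(1 + 4 * real n / F\<^sub>0) ^ t / (real n + 1) \<le> exp (ln (real n) / 2) / real n"
      using n by (intro frac_le) auto
    have "(1 - p / (2 * real n)) ^ R \<le> exp (- (p / (2 * real n))) ^ R"
      using exp_ge_add_one_self[of "- (p / (2 * real n))"] p1 n
      by (intro power_mono) (auto simp: field_simps)
    also have "\<dots> = exp (real R * (- (p / (2 * real n))))" by (rule exp_of_nat_mult[symmetric])
    also have "\<dots> = exp (- (p * real R / (2 * real n)))" by (simp add: mult.commute)
    also have "\<dots> \<le> exp (- (exp (- (1 - \<beta> / 2) * L)
        * (real n * ln (real n) / (32 * ((1 - \<beta>) * L + 1)) - 1) / (2 * real n)))"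
    proof -
      have "real n * ln (real n) / (32 * ((1 - \<beta>) * L + 1)) \<le> real n * ln (real n) / (32 * (real a + 1))"
        using a n by (intro divide_left_mono) auto
      then have "exp (- (1 - \<beta> / 2) * L) * (real n * ln (real n) / (32 * ((1 - \<beta>) * L + 1)) - 1)
          \<le> exp (- (1 - \<beta> / 2) * L) * real R"
        using R(2) by (intro mult_left_mono) auto
      also have "\<dots> \<le> p * real R" using p by (intro mult_right_mono) auto
      finally show ?thesis using n by (simp add: divide_right_mono)
    qed
    finally show "(1 - p / (2 * real n)) ^ R \<le> exp (- (exp (- (1 - \<beta> / 2) * L)
        * (real n * ln (real n) / (32 * ((1 - \<beta>) * L + 1)) - 1) / (2 * real n)))" .
  qed auto
  finally show ?thesis .
qed

theorem maker_loses_below_threshold: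
  assumes \<epsilon>: "0 < \<epsilon>" and a: "rounding a (\<lambda>n. (1 - \<epsilon>) * ln (ln (real n)))" and k: "0 < k"
  shows "maker_loses_aas (min_degree_game k) a (\<lambda>n. isolating_breaker n (a n))"
proof -
  \<comment> \<open>The truncation keeps \<open>1 - \<beta>\<close> positive even if \<open>\<epsilon> \<ge> 1\<close>, when the bias is eventually rounded to \<open>0\<close>.\<close>
  define \<beta> where "\<beta> = min (\<epsilon> / 2) (1 / 2)"
  have \<beta>: "0 < \<beta>" "\<beta> \<le> 1 / 2" "\<beta> \<le> \<epsilon> / 2" using \<epsilon> by (auto simp: \<beta>_def)
  let ?P = "\<lambda>n. measure_pmf.prob (half_random_game n (a n) (isolating_breaker n (a n)))"
  let ?win = "\<lambda>n. ?P n {h. min_degree_game k n (maker_edges (a n) h)}"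
  let ?F = "\<lambda>n. real n * (real n - 1) / 2 - real n * ln (real n) / 32"
  let ?bound = "\<lambda>n. exp (ln (real n) / 2) / real n
      + 2 * exp (- (exp (- (1 - \<beta> / 2) * ln (ln (real n)))
          * (real n * ln (real n) / (32 * ((1 - \<beta>) * ln (ln (real n)) + 1)) - 1) / (2 * real n)))"
  have "eventually (\<lambda>n. ?win n \<le> ?bound n) sequentially"
  proof -
    have "eventually (\<lambda>n. 0 < n) sequentially" by (rule eventually_gt_at_top)
    moreover have "eventually (\<lambda>n. 1 \<le> ln (real n)) sequentially" by real_asymp
    moreover have "eventually (\<lambda>n. 2 \<le> ln (ln (real n))) sequentially" by real_asymp
    moreover have "eventually (\<lambda>n. 1 \<le> \<epsilon> / 2 * ln (ln (real n))) sequentially"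
      using \<epsilon> by real_asymp
    moreover have "eventually (\<lambda>n. real n * real n / 4 \<le> ?F n) sequentially" by real_asymp
    moreover have "eventually (\<lambda>n. real n * (real n + 1) / 2 \<le> (1 + \<beta> / 4) * ?F n) sequentially"
      using \<beta>(1) by real_asymp
    moreover have "eventually (\<lambda>n. real n / ?F n \<le> \<beta> / 4 / (1 + \<beta> / 4)) sequentially"
    proof -
      have "(\<lambda>n. real n / ?F n) \<longlonglongrightarrow> 0" by real_asymp
      moreover have "0 < \<beta> / 4 / (1 + \<beta> / 4)" using \<beta>(1) by simp
      ultimately have "eventually (\<lambda>n. real n / ?F n < \<beta> / 4 / (1 + \<beta> / 4)) sequentially"
        by (rule order_tendstoD(2))
      then show ?thesis by eventually_elim simp
    qed
    ultimately show ?thesis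
    proof eventually_elim
      case (elim n)
      let ?L = "ln (ln (real n))"
      have "real (a n) \<le> (1 - \<beta>) * ?L"
      proof (cases "0 \<le> (1 - \<epsilon>) * ?L")
        case True
        have "\<epsilon> / 2 * ?L \<le> (\<epsilon> - \<beta>) * ?L" using \<beta> elim(3) by (intro mult_right_mono) auto
        then have "(1 - \<epsilon>) * ?L + 1 \<le> (1 - \<beta>) * ?L" using elim(4) by (simp add: algebra_simps)
        then show ?thesis
          using rounding_bounds(2)[of a "\<lambda>n. (1 - \<epsilon>) * ln (ln (real n))", OF a True] by linarith
      next
        case False
        then have "nat \<lfloor>(1 - \<epsilon>) * ?L\<rfloor> = 0" "nat \<lceil>(1 - \<epsilon>) * ?L\<rceil> = 0" by linarith+
        then have "a n = 0" using a unfolding rounding_def by metis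
        then show ?thesis using \<beta> elim(3) by simp
      qed
      then show ?case
        using elim \<beta> by (intro prob_maker_wins_le_explicit k) auto
    qed
  qed
  moreover have "?bound \<longlonglongrightarrow> 0"
  proof -
    have 1: "(\<lambda>n. exp (ln (real n) / 2) / real n) \<longlonglongrightarrow> 0" by real_asymp
    have "0 < 1 - \<beta>" "0 < 1 - \<beta> / 2" using \<beta> by auto
    then have 2: "(\<lambda>n. 2 * exp (- (exp (- (1 - \<beta> / 2) * ln (ln (real n)))
          * (real n * ln (real n) / (32 * ((1 - \<beta>) * ln (ln (real n)) + 1)) - 1) / (2 * real n)))) \<longlonglongrightarrow> 0"
      using \<beta>(1) by real_asymp
    show ?thesis using tendsto_add[OF 1 2] by simp
  qed
  ultimately have "?win \<longlonglongrightarrow> 0"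
    by (rule tendsto_sandwich[OF always_eventually[rule_format, OF measure_nonneg] _ tendsto_const])
  then have "(\<lambda>n. 1 - ?win n) \<longlonglongrightarrow> 1 - 0" by (intro tendsto_diff tendsto_const)
  then show ?thesis by (simp add: maker_loses_aas_def prob_Collect_not)
qed

section \<open>The sharp threshold\<close>

theorem theorem1p3:
  fixes k :: nat
  assumes "k > 0"
  shows "sharp_threshold_bias (min_degree_game k) (\<lambda>n. ln (ln (real n)))"
  unfolding sharp_threshold_bias_def
proof (intro allI impI conjI)
  fix \<epsilon> :: real and a S
  assume "0 < \<epsilon>" "rounding a (\<lambda>n. (1 + \<epsilon>) * ln (ln (real n)))" "\<forall>n. breaker_strategy n (a n) (S n)"
  then show "maker_wins_aas (min_degree_game k) a S"
    using maker_wins_above_threshold by blast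
next
  fix \<epsilon> :: real and a
  assume "0 < \<epsilon>" "rounding a (\<lambda>n. (1 - \<epsilon>) * ln (ln (real n)))"
  then have "maker_loses_aas (min_degree_game k) a (\<lambda>n. isolating_breaker n (a n))"
    using assms by (rule maker_loses_below_threshold)
  then show "\<exists>S. (\<forall>n. breaker_strategy n (a n) (S n)) \<and> maker_loses_aas (min_degree_game k) a S"
    using breaker_strategy_isolating by (intro exI[of _ "\<lambda>n. isolating_breaker n (a n)"]) simp
qed

end
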